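(* Let $n\ge 1$, $t_1,\dots,t_n>0$ and $\alpha_1,\dots,\alpha_n\in(0,1)$, and consider the search game $G$, with value $v^*$, and the iterative algorithm described in the context, run with tolerance $\epsilon>0$. Then $L_k\le v^*\le U_k$ in every iteration $k$ that is reached. Moreover, if the algorithm terminates in iteration $k$, then $U_k/L_k-1<\epsilon$, the output hiding strategy $\mathbf p_k$ guarantees the hider an expected time to detection of at least $L_k$ (that is, $u(\mathbf p_k,\xi)\ge L_k$ for every search sequence $\xi\in\mathcal C$), and the output search strategy $\theta$ guarantees the searcher an expected time to detection of at most $U_k$ (that is, $u(i,\theta)\le U_k$ for every box $i\in\{1,\dots,n\}$).
   Context: **Search game $G$.** A hider hides in one of $n$ boxes; a searcher searches boxes one at a time. A search of box $i$ takes time $t_i>0$ and finds the hider, if hidden there, with probability $\alpha_i\in(0,1)$, independently of all other searches. A pure search strategy (search sequence) is an element $\xi$ of $\mathcal C=\{1,\dots,n\}^{\infty}$, the ordered infinite list of boxes to search. A mixed hiding strategy is $\mathbf p=(p_1,\dots,p_n)$ in the probability simplex $\Delta^n$. A mixed search strategy is a probability distribution $\theta$ on $\mathcal C$ with finite support. For a box $i$ and $\xi\in\mathcal C$, $u(i,\xi)\in(0,\infty]$ is the expected total search time until detection (including the detecting search) when the hider is in box $i$ and the searcher follows $\xi$: $u(i,\xi)=\sum_{r\ge1}\alpha_i(1-\alpha_i)^{r-1}\tau_i(r,\xi)$, with $\tau_i(r,\xi)$ the time at which the $r$th search of box $i$ is completed under $\xi$, and $u(i,\xi)=\infty$ if box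 $i$ is searched only finitely often. Put $u(\mathbf p,\xi)=\sum_i p_iu(i,\xi)$ (with $0\cdot\infty=0$), $u(i,\theta)=\sum_\xi\theta(\xi)u(i,\xi)$, $u(\mathbf p,\theta)=\sum_\xi\theta(\xi)u(\mathbf p,\xi)$, and $u(\mathbf p)=\min_{\xi\in\mathcal C}u(\mathbf p,\xi)$. The hider maximizes and the searcher minimizes the expected time to detection. It is known that $G$ has a value $v^*=\max_{\mathbf p\in\Delta^n}u(\mathbf p)=\min_\theta\max_i u(i,\theta)$ and that both players have optimal strategies. **Gittins search sequences.** $\xi\in\mathcal C$ is a Gittins search sequence against $\mathbf p$ if at every stage, when $m_i$ searches of box $i$ have already been made ($i=1,\dots,n$), the next box searched is some $j$ attaining $\max_i p_i(1-\alpha_i)^{m_i}\alpha_i/t_i$. It is known that these are exactly the minimizers of $u(\mathbf p,\cdot)$. The Gittins search sequence that breaks ties by a given preference ordering (a permutation of the boxes) always chooses, among the boxes attaining the maximum, the one coming first in that ordering. **Constants.** $M=\sum_{i=1}^n t_i/\alpha_i$, $m_i=\lfloor M/t_i\rfloor+1$, $c_i=\sum_{j\ne i}\frac{t_j}{\alpha_j(1-\alpha_j)^{m_j-1}}$, $\eta_i=\frac{t_i/\alpha_i}{t_i/\alpha_i+c_i}$. Fix constants $0<\delta_i<\eta_i$, $i=1,\dots,n$, and let $\Delta^n_+=\{\mathbf p:\sum_i p_i=1,\ p_i\ge\delta_i \text{ for all } i\}$. **Algorithm** (with tolerance $\epsilon>0$). 1. Let $\mathbf p_0=(p_{0,1},\dots,p_{0,n})$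 with $p_{0,i}=\frac{t_i/\alpha_i}{\sum_j t_j/\alpha_j}$. Let $\mathcal D_1$ be the set of the $n$ Gittins search sequences against $\mathbf p_0$ that break all ties by the preference orderings $(1,2,\dots,n)$, $(2,3,\dots,n,1)$, ..., $(n,1,\dots,n-1)$, respectively. Set $k=1$. 2. In iteration $k$, let $G_k$ be the game in which the searcher's pure strategy set is $\mathcal D_k$ and the hider is constrained to mixed strategies in $\Delta^n_+$. Let $(\mathbf p_k,v_k)$ be an optimal solution of the linear program: maximize $v$ over $(\mathbf p,v)$ subject to $v\le\sum_{i=1}^n p_iu(i,\xi)$ for all $\xi\in\mathcal D_k$; $p_i\ge\delta_i$ for $i=1,\dots,n$; $\sum_{i=1}^n p_i=1$. Thus $\mathbf p_k$ is optimal for the hider in $G_k$ and $v_k$ is the value of $G_k$. 3. Set $U_k=v_k$. Choose a Gittins search sequence $\xi_k$ against $\mathbf p_k$ and set $L_k=u(\mathbf p_k)=u(\mathbf p_k,\xi_k)$. 4. If (i) $U_k/L_k-1<\epsilon$ and (ii) none of the constraints $p_i\ge\delta_i$ is binding at $\mathbf p_k$ (i.e. every coordinate $i$ of $\mathbf p_k$ is strictly larger than $\delta_i$), terminate and go to step 5. Otherwise set $\mathcal D_{k+1}=\mathcal D_k\cup\{\xi_k\}$, and go to step 2 with $k+1$ in place of $k$. 5. Let $\theta$ be an optimal strategy of the searcher in $G_k$, i.e. a probability distribution on $\mathcal D_k$ minimizing $\max_{\mathbf p\in\Delta^n_+}u(\mathbf p,\theta)$. Output $\mathbf p_k$, $\theta$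 and $U_k$. *)

theory Defs
  imports "HOL-Probability.Probability_Mass_Function"
begin

text \<open>
  Boxes are the numbers \<open>1, ..., n\<close>; data indexed by boxes (search times \<open>t\<close>, detection
  probabilities \<open>\<alpha>\<close>, hiding strategies \<open>p\<close>, ...) are functions on \<^typ>\<open>nat\<close> of which only the
  values on \<open>{1..n}\<close> are used. A search sequence \<open>\<xi>\<close> is indexed from \<open>0\<close>: \<open>\<xi> s\<close> is the box
  searched at stage \<open>s\<close>, after \<open>s\<close> searches have been made. Expected times are extended reals,
  where \<open>0 * \<infinity> = 0\<close>.
\<close>

section \<open>The search game\<close>

definition search_seqs :: "nat \<Rightarrow> (nat \<Rightarrow> nat) set" where
  "search_seqs n = {\<xi>. \<forall>s. \<xi> s \<in> {1..n}}"

definition hiding_strategies :: "nat \<Rightarrow> (nat \<Rightarrow> real) set" where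
  "hiding_strategies n = {p. (\<forall>i\<in>{1..n}. 0 \<le> p i) \<and> (\<Sum>i=1..n. p i) = 1}"

definition mixed_strategies :: "(nat \<Rightarrow> nat) set \<Rightarrow> (nat \<Rightarrow> nat) pmf set" where
  "mixed_strategies A = {\<theta>. finite (set_pmf \<theta>) \<and> set_pmf \<theta> \<subseteq> A}"

text \<open>
  Completion time of the \<open>r\<close>th search (\<open>r \<ge> 1\<close>) of box \<open>i\<close>; only meaningful if \<open>i\<close> is searched
  infinitely often.
\<close>

definition completion_time :: "(nat \<Rightarrow> real) \<Rightarrow> (nat \<Rightarrow> nat) \<Rightarrow> nat \<Rightarrow> nat \<Rightarrow> real" where
  "completion_time t \<xi> i r = (\<Sum>s\<le>Infinite_Set.enumerate {s. \<xi> s = i} (r - 1). t (\<xi> s))"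

text \<open>The summation index below is \<open>r - 1\<close>.\<close>

definition u_box :: "(nat \<Rightarrow> real) \<Rightarrow> (nat \<Rightarrow> real) \<Rightarrow> nat \<Rightarrow> (nat \<Rightarrow> nat) \<Rightarrow> ereal" where
  "u_box t \<alpha> i \<xi> =
     (if infinite {s. \<xi> s = i}
      then (\<Sum>r. ereal (\<alpha> i * (1 - \<alpha> i) ^ r * completion_time t \<xi> i (Suc r)))
      else \<infinity>)"

definition u_hide ::
  "nat \<Rightarrow> (nat \<Rightarrow> real) \<Rightarrow> (nat \<Rightarrow> real) \<Rightarrow> (nat \<Rightarrow> real) \<Rightarrow> (nat \<Rightarrow> nat) \<Rightarrow> ereal" where
  "u_hide n t \<alpha> p \<xi> = (\<Sum>i=1..n. ereal (p i) * u_box t \<alpha> i \<xi>)"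

definition u_box_mixed ::
  "(nat \<Rightarrow> real) \<Rightarrow> (nat \<Rightarrow> real) \<Rightarrow> nat \<Rightarrow> (nat \<Rightarrow> nat) pmf \<Rightarrow> ereal" where
  "u_box_mixed t \<alpha> i \<theta> = (\<Sum>\<xi>\<in>set_pmf \<theta>. ereal (pmf \<theta> \<xi>) * u_box t \<alpha> i \<xi>)"

definition u_mixed ::
  "nat \<Rightarrow> (nat \<Rightarrow> real) \<Rightarrow> (nat \<Rightarrow> real) \<Rightarrow> (nat \<Rightarrow> real) \<Rightarrow> (nat \<Rightarrow> nat) pmf \<Rightarrow> ereal" where
  "u_mixed n t \<alpha> p \<theta> = (\<Sum>\<xi>\<in>set_pmf \<theta>. ereal (pmf \<theta> \<xi>) * u_hide n t \<alpha> p \<xi>)"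

definition u_min :: "nat \<Rightarrow> (nat \<Rightarrow> real) \<Rightarrow> (nat \<Rightarrow> real) \<Rightarrow> (nat \<Rightarrow> real) \<Rightarrow> ereal" where
  "u_min n t \<alpha> p = (INF \<xi>\<in>search_seqs n. u_hide n t \<alpha> p \<xi>)"

text \<open>
  The value \<open>v* = max\<^sub>p u(p)\<close>, written with suprema and infima so that attainment need not be
  assumed; see \<open>game_value_eqI\<close> below for the agreement with the two-sided value.
\<close>

definition game_value :: "nat \<Rightarrow> (nat \<Rightarrow> real) \<Rightarrow> (nat \<Rightarrow> real) \<Rightarrow> ereal" where
  "game_value n t \<alpha> = (SUP p\<in>hiding_strategies n. u_min n t \<alpha> p)"

section \<open>Gittins search sequences\<close>

definition num_searches :: "(nat \<Rightarrow> nat) \<Rightarrow> nat \<Rightarrow> nat \<Rightarrow> nat" where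
  "num_searches \<xi> s i = card {r. r < s \<and> \<xi> r = i}"

definition gittins_index ::
  "(nat \<Rightarrow> real) \<Rightarrow> (nat \<Rightarrow> real) \<Rightarrow> (nat \<Rightarrow> real) \<Rightarrow> (nat \<Rightarrow> nat) \<Rightarrow> nat \<Rightarrow> real" where
  "gittins_index t \<alpha> p m i = p i * (1 - \<alpha> i) ^ m i * \<alpha> i / t i"

definition gittins_boxes ::
  "nat \<Rightarrow> (nat \<Rightarrow> real) \<Rightarrow> (nat \<Rightarrow> real) \<Rightarrow> (nat \<Rightarrow> real) \<Rightarrow> (nat \<Rightarrow> nat) \<Rightarrow> nat set" where
  "gittins_boxes n t \<alpha> p m =
     {j\<in>{1..n}. \<forall>i\<in>{1..n}. gittins_index t \<alpha> p m i \<le> gittins_index t \<alpha> p m j}"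

definition gittins_seq ::
  "nat \<Rightarrow> (nat \<Rightarrow> real) \<Rightarrow> (nat \<Rightarrow> real) \<Rightarrow> (nat \<Rightarrow> real) \<Rightarrow> (nat \<Rightarrow> nat) \<Rightarrow> bool" where
  "gittins_seq n t \<alpha> p \<xi> \<longleftrightarrow> (\<forall>s. \<xi> s \<in> gittins_boxes n t \<alpha> p (num_searches \<xi> s))"

text \<open>A preference ordering is given as a list of the boxes, most preferred box first.\<close>

definition gittins_seq_pref ::
  "nat \<Rightarrow> (nat \<Rightarrow> real) \<Rightarrow> (nat \<Rightarrow> real) \<Rightarrow> nat list \<Rightarrow> (nat \<Rightarrow> real) \<Rightarrow> (nat \<Rightarrow> nat) \<Rightarrow> bool" where
  "gittins_seq_pref n t \<alpha> ord p \<xi> \<longleftrightarrow>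
     (\<forall>s. find (\<lambda>j. j \<in> gittins_boxes n t \<alpha> p (num_searches \<xi> s)) ord = Some (\<xi> s))"

section \<open>The lower bounds on the hiding probabilities\<close>

definition M_const :: "nat \<Rightarrow> (nat \<Rightarrow> real) \<Rightarrow> (nat \<Rightarrow> real) \<Rightarrow> real" where
  "M_const n t \<alpha> = (\<Sum>i=1..n. t i / \<alpha> i)"

definition m_const :: "nat \<Rightarrow> (nat \<Rightarrow> real) \<Rightarrow> (nat \<Rightarrow> real) \<Rightarrow> nat \<Rightarrow> nat" where
  "m_const n t \<alpha> i = nat \<lfloor>M_const n t \<alpha> / t i\<rfloor> + 1"

definition c_const :: "nat \<Rightarrow> (nat \<Rightarrow> real) \<Rightarrow> (nat \<Rightarrow> real) \<Rightarrow> nat \<Rightarrow> real" where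
  "c_const n t \<alpha> i = (\<Sum>j\<in>{1..n} - {i}. t j / (\<alpha> j * (1 - \<alpha> j) ^ (m_const n t \<alpha> j - 1)))"

definition \<eta>_const :: "nat \<Rightarrow> (nat \<Rightarrow> real) \<Rightarrow> (nat \<Rightarrow> real) \<Rightarrow> nat \<Rightarrow> real" where
  "\<eta>_const n t \<alpha> i = (t i / \<alpha> i) / (t i / \<alpha> i + c_const n t \<alpha> i)"

definition restricted_strategies :: "nat \<Rightarrow> (nat \<Rightarrow> real) \<Rightarrow> (nat \<Rightarrow> real) set" where
  "restricted_strategies n \<delta> = {p. (\<forall>i\<in>{1..n}. \<delta> i \<le> p i) \<and> (\<Sum>i=1..n. p i) = 1}"

section \<open>The algorithm\<close>

definition p_init :: "nat \<Rightarrow> (nat \<Rightarrow> real) \<Rightarrow> (nat \<Rightarrow> real) \<Rightarrow> nat \<Rightarrow> real" where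
  "p_init n t \<alpha> i = (t i / \<alpha> i) / (\<Sum>j=1..n. t j / \<alpha> j)"

definition D_init :: "nat \<Rightarrow> (nat \<Rightarrow> real) \<Rightarrow> (nat \<Rightarrow> real) \<Rightarrow> (nat \<Rightarrow> nat) set" where
  "D_init n t \<alpha> = {\<xi>. \<exists>l<n. gittins_seq_pref n t \<alpha> (rotate l [1..<Suc n]) (p_init n t \<alpha>) \<xi>}"

definition lp_feasible ::
  "nat \<Rightarrow> (nat \<Rightarrow> real) \<Rightarrow> (nat \<Rightarrow> real) \<Rightarrow> (nat \<Rightarrow> real) \<Rightarrow> (nat \<Rightarrow> nat) set
    \<Rightarrow> (nat \<Rightarrow> real) \<Rightarrow> real \<Rightarrow> bool" where
  "lp_feasible n t \<alpha> \<delta> D p v \<longleftrightarrow>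
     (\<forall>\<xi>\<in>D. ereal v \<le> u_hide n t \<alpha> p \<xi>) \<and> p \<in> restricted_strategies n \<delta>"

definition lp_optimal ::
  "nat \<Rightarrow> (nat \<Rightarrow> real) \<Rightarrow> (nat \<Rightarrow> real) \<Rightarrow> (nat \<Rightarrow> real) \<Rightarrow> (nat \<Rightarrow> nat) set
    \<Rightarrow> (nat \<Rightarrow> real) \<Rightarrow> real \<Rightarrow> bool" where
  "lp_optimal n t \<alpha> \<delta> D p v \<longleftrightarrow>
     lp_feasible n t \<alpha> \<delta> D p v \<and> (\<forall>p' v'. lp_feasible n t \<alpha> \<delta> D p' v' \<longrightarrow> v' \<le> v)"

definition stop_condition ::
  "nat \<Rightarrow> (nat \<Rightarrow> real) \<Rightarrow> real \<Rightarrow> (nat \<Rightarrow> real) \<Rightarrow> real \<Rightarrow> ereal \<Rightarrow> bool" where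
  "stop_condition n \<delta> \<epsilon> p U L \<longleftrightarrow> ereal U / L - 1 < ereal \<epsilon> \<and> (\<forall>i\<in>{1..n}. \<delta> i < p i)"

text \<open>
  \<open>algorithm_run n t \<alpha> \<delta> \<epsilon> K D p v \<xi> U L\<close>: the sequences \<open>D\<close>, \<open>p\<close>, \<open>v\<close>, \<open>\<xi>\<close>, \<open>U\<close>, \<open>L\<close>
  record, for iterations \<open>1, ..., K\<close>, a possible execution of the algorithm that reaches
  iteration \<open>K\<close> and carries out steps 2 and 3 in it; the LP solutions and the Gittins sequences
  may be chosen arbitrarily. The lower bound is the computed quantity \<open>u(p\<^sub>k, \<xi>\<^sub>k)\<close>, so that its
  being equal to \<open>u(p\<^sub>k)\<close> is not built in.
\<close>

definition algorithm_run ::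
  "nat \<Rightarrow> (nat \<Rightarrow> real) \<Rightarrow> (nat \<Rightarrow> real) \<Rightarrow> (nat \<Rightarrow> real) \<Rightarrow> real \<Rightarrow> nat
    \<Rightarrow> (nat \<Rightarrow> (nat \<Rightarrow> nat) set) \<Rightarrow> (nat \<Rightarrow> nat \<Rightarrow> real) \<Rightarrow> (nat \<Rightarrow> real) \<Rightarrow> (nat \<Rightarrow> nat \<Rightarrow> nat)
    \<Rightarrow> (nat \<Rightarrow> real) \<Rightarrow> (nat \<Rightarrow> ereal) \<Rightarrow> bool" where
  "algorithm_run n t \<alpha> \<delta> \<epsilon> K D p v \<xi> U L \<longleftrightarrow>
     1 \<le> K \<and> D 1 = D_init n t \<alpha> \<and>
     (\<forall>k\<in>{1..K}. lp_optimal n t \<alpha> \<delta> (D k) (p k) (v k) \<and> U k = v k \<and>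
        gittins_seq n t \<alpha> (p k) (\<xi> k) \<and> L k = u_hide n t \<alpha> (p k) (\<xi> k)) \<and>
     (\<forall>k\<in>{1..<K}. \<not> stop_condition n \<delta> \<epsilon> (p k) (U k) (L k) \<and>
        D (Suc k) = insert (\<xi> k) (D k))"

definition optimal_search ::
  "nat \<Rightarrow> (nat \<Rightarrow> real) \<Rightarrow> (nat \<Rightarrow> real) \<Rightarrow> (nat \<Rightarrow> real) \<Rightarrow> (nat \<Rightarrow> nat) set
    \<Rightarrow> (nat \<Rightarrow> nat) pmf \<Rightarrow> bool" where
  "optimal_search n t \<alpha> \<delta> D \<theta> \<longleftrightarrow>
     is_arg_min (\<lambda>\<theta>. SUP p\<in>restricted_strategies n \<delta>. u_mixed n t \<alpha> p \<theta>)
       (\<lambda>\<theta>. \<theta> \<in> mixed_strategies D) \<theta>"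

section \<open>The value is two-sided\<close>

lemma u_box_nonneg:
  assumes "\<xi> \<in> search_seqs n" "i \<in> {1..n}"
    and "\<And>j. j \<in> {1..n} \<Longrightarrow> 0 < t j" "\<And>j. j \<in> {1..n} \<Longrightarrow> \<alpha> j \<in> {0<..<1}"
  shows "0 \<le> u_box t \<alpha> i \<xi>"
proof -
  have t: "0 \<le> t (\<xi> s)" for s
    using assms(1,3) by (auto simp: search_seqs_def less_imp_le)
  have "0 \<le> completion_time t \<xi> i r" for r
    unfolding completion_time_def by (intro sum_nonneg t)
  moreover have "0 < \<alpha> i" "\<alpha> i < 1"
    using assms(2,4) by auto
  ultimately show ?thesis
    by (auto simp: u_box_def intro!: suminf_nonneg summable_ereal_pos mult_nonneg_nonneg)
qed

text \<open>
  If the game has a value \<open>V\<close> in the usual sense, witnessed by a pair of optimal strategies, then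
  \<open>V\<close> is \<^const>\<open>game_value\<close>.
\<close>

lemma game_value_eqI:
  assumes pos: "\<And>j. j \<in> {1..n} \<Longrightarrow> 0 < t j" "\<And>j. j \<in> {1..n} \<Longrightarrow> \<alpha> j \<in> {0<..<1}"
    and p: "p \<in> hiding_strategies n" "\<And>\<xi>. \<xi> \<in> search_seqs n \<Longrightarrow> V \<le> u_hide n t \<alpha> p \<xi>"
    and \<theta>: "\<theta> \<in> mixed_strategies (search_seqs n)" "\<And>i. i \<in> {1..n} \<Longrightarrow> u_box_mixed t \<alpha> i \<theta> \<le> V"
  shows "game_value n t \<alpha> = V"
proof (rule antisym)
  have fin: "finite (set_pmf \<theta>)" and sub: "set_pmf \<theta> \<subseteq> search_seqs n"
    using \<theta>(1) by (auto simp: mixed_strategies_def)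
  have sum1: "(\<Sum>\<xi>\<in>set_pmf \<theta>. pmf \<theta> \<xi>) = 1"
    using fin by (simp add: sum_pmf_eq_1)
  have nn: "0 \<le> u_box t \<alpha> i \<xi>" if "\<xi> \<in> set_pmf \<theta>" "i \<in> {1..n}" for \<xi> i
    using that sub pos by (intro u_box_nonneg[of _ n]) auto
  have "u_min n t \<alpha> q \<le> V" if q: "q \<in> hiding_strategies n" for q
  proof -
    have q0: "0 \<le> q i" if "i \<in> {1..n}" for i
      using q that by (auto simp: hiding_strategies_def)
    have qs: "(\<Sum>i=1..n. q i) = 1"
      using q by (auto simp: hiding_strategies_def)
    have "u_min n t \<alpha> q = (\<Sum>\<xi>\<in>set_pmf \<theta>. ereal (pmf \<theta> \<xi>)) * u_min n t \<alpha> q"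
      using sum1 by (simp flip: one_ereal_def)
    also have "\<dots> = (\<Sum>\<xi>\<in>set_pmf \<theta>. ereal (pmf \<theta> \<xi>) * u_min n t \<alpha> q)"
      by (rule sum_ereal_left_distrib) simp
    also have "\<dots> \<le> (\<Sum>\<xi>\<in>set_pmf \<theta>. ereal (pmf \<theta> \<xi>) * u_hide n t \<alpha> q \<xi>)"
      using sub by (intro sum_mono ereal_mult_left_mono) (auto simp: u_min_def intro!: INF_lower)
    also have "\<dots> = (\<Sum>\<xi>\<in>set_pmf \<theta>. \<Sum>i=1..n. ereal (q i) * (ereal (pmf \<theta> \<xi>) * u_box t \<alpha> i \<xi>))"
      unfolding u_hide_def
      by (intro sum.cong refl, subst sum_ereal_right_distrib)
         (auto simp: q0 nn mult.left_commute)
    also have "\<dots> = (\<Sum>i=1..n. \<Sum>\<xi>\<in>set_pmf \<theta>. ereal (q i) * (ereal (pmf \<theta> \<xi>) * u_box t \<alpha> i \<xi>))"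
      by (rule sum.swap)
    also have "\<dots> = (\<Sum>i=1..n. ereal (q i) * u_box_mixed t \<alpha> i \<theta>)"
      unfolding u_box_mixed_def
      by (intro sum.cong refl, subst sum_ereal_right_distrib) (auto simp: nn)
    also have "\<dots> \<le> (\<Sum>i=1..n. ereal (q i) * V)"
      using q0 \<theta>(2) by (intro sum_mono ereal_mult_left_mono) auto
    also have "\<dots> = (\<Sum>i=1..n. ereal (q i)) * V"
      by (rule sum_ereal_left_distrib[symmetric]) (use q0 in auto)
    also have "\<dots> = V"
      using qs by (simp flip: one_ereal_def)
    finally show ?thesis .
  qed
  then show "game_value n t \<alpha> \<le> V"
    unfolding game_value_def by (rule SUP_least)
  have "V \<le> u_min n t \<alpha> p"
    unfolding u_min_def using p(2) by (rule INF_greatest)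
  also have "\<dots> \<le> game_value n t \<alpha>"
    unfolding game_value_def using p(1) by (rule SUP_upper)
  finally show "V \<le> game_value n t \<alpha>" .
qed

end

theory Submission imports Defs begin

text \<open>
  A search sequence visits the jobs \<open>(i, r)\<close>, the searches of box \<open>i\<close> after \<open>r\<close> previous ones, which
  have weight \<open>p\<^sub>i \<alpha>\<^sub>i (1 - \<alpha>\<^sub>i)^r\<close> and duration \<open>t\<^sub>i\<close>, and \<open>u(p, \<xi>)\<close> is the total weighted completion
  time. Comparing jobs in pairs, as in Smith's rule, shows that Gittins sequences are optimal; hence
  \<open>L\<^sub>k = u(p\<^sub>k) \<le> v*\<close>.

  For \<open>v* \<le> U\<^sub>k\<close> it suffices that every \<open>p\<close> is dominated by some \<open>q\<close> with \<open>q\<^sub>i \<ge> \<delta>\<^sub>i\<close>. Always \<open>u(p) \<le> M\<close>,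
  whereas a Gittins sequence against \<open>q\<close> needs time at least \<open>M\<close> to find the hider in a box with
  \<open>q\<^sub>i < \<eta>\<^sub>i\<close>; so moving mass from \<open>p\<close> to such boxes does not hurt the hider.

  If no constraint is binding at \<open>p\<^sub>k\<close>, optimality of \<open>(p\<^sub>k, v\<^sub>k)\<close> extends from the restricted
  strategies to the whole simplex. Approachability of the orthant then gives the searcher mixtures
  of \<open>D\<^sub>k\<close> that cost at most \<open>v\<^sub>k + \<gamma>\<close> in every box, for any \<open>\<gamma> > 0\<close>, so the optimal \<open>\<theta>\<close> satisfies \<open>u(q, \<theta>) \<le> v\<^sub>k\<close> for all
  restricted \<open>q\<close>, with equality at the interior point \<open>p\<^sub>k\<close>. A linear function that is maximal at an
  interior point is constant, which bounds \<open>u(i, \<theta>)\<close> for every box \<open>i\<close>.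
\<close>

section \<open>Smith's rule\<close>

text \<open>As integrals over counting measure, series of nonnegative terms can be interchanged
  without any convergence condition.\<close>

lemma suminf_ereal_eq_nn_integral:
  assumes "\<And>r::nat. 0 \<le> f r"
  shows "(\<Sum>r. ereal (f r)) = enn2ereal (\<integral>\<^sup>+r. ennreal (f r) \<partial>count_space UNIV)"
  using assms by (simp add: nn_integral_count_space_nat enn2ereal_ennreal flip: suminf_enn2ereal)

lemma nn_integral_count_space_Times:
  assumes "finite A"
  shows "(\<integral>\<^sup>+a. f a \<partial>count_space (A \<times> UNIV)) = (\<Sum>i\<in>A. \<integral>\<^sup>+r. f (i, r) \<partial>count_space UNIV)"
proof -
  have "(\<integral>\<^sup>+a. f a \<partial>count_space (A \<times> UNIV)) =
      (\<integral>\<^sup>+a. f a * indicator (A \<times> UNIV) a \<partial>count_space UNIV)"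
    by (simp add: nn_integral_count_space_indicator)
  also have "\<dots> = (\<integral>\<^sup>+i. \<integral>\<^sup>+r. f (i, r) * indicator (A \<times> UNIV) (i, r) \<partial>count_space UNIV \<partial>count_space UNIV)"
    by (rule nn_integral_fst_count_space[symmetric])
  also have "\<dots> = (\<integral>\<^sup>+i. (\<integral>\<^sup>+r. f (i, r) \<partial>count_space UNIV) * indicator A i \<partial>count_space UNIV)"
    by (intro nn_integral_cong) (auto split: split_indicator)
  also have "\<dots> = (\<integral>\<^sup>+i. (\<integral>\<^sup>+r. f (i, r) \<partial>count_space UNIV) \<partial>count_space A)"
    by (simp add: nn_integral_count_space_indicator)
  finally show ?thesis
    using assms by (simp add: nn_integral_count_space_finite)
qed

text \<open>Here \<open>w\<close> is a weight, \<open>\<tau>\<close> a duration and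
  \<open>pos\<close> a place in the schedule, so both sides are total weighted completion times.
  Each pair of distinct jobs contributes exactly one of \<open>w a * \<tau> b\<close> and
  \<open>w b * \<tau> a\<close>, and \<open>pos\<close> picks the smaller.\<close>

lemma smith_rule:
  fixes pos pos' :: "'a \<Rightarrow> nat" and w \<tau> :: "'a \<Rightarrow> ennreal"
  assumes J: "countable J" and inj: "inj_on pos J" "inj_on pos' J"
    and ratio: "\<And>a b. a \<in> J \<Longrightarrow> b \<in> J \<Longrightarrow> pos b \<le> pos a \<Longrightarrow> w a * \<tau> b \<le> w b * \<tau> a"
  shows "(\<integral>\<^sup>+a. \<integral>\<^sup>+b. of_bool (pos b \<le> pos a) * (w a * \<tau> b) \<partial>count_space J \<partial>count_space J) \<le>
    (\<integral>\<^sup>+a. \<integral>\<^sup>+b. of_bool (pos' b \<le> pos' a) * (w a * \<tau> b) \<partial>count_space J \<partial>count_space J)"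
    (is "?C pos \<le> ?C pos'")
proof -
  \<comment> \<open>Symmetrizing doubles the cost and lets pairs be compared term by term, without
    subtracting possibly infinite sums.\<close>
  define h where "h f a b = of_bool (f b \<le> f a) * (w a * \<tau> b) + of_bool (f a \<le> f b) * (w b * \<tau> a)"
    for f :: "'a \<Rightarrow> nat" and a b
  have double: "?C f + ?C f = (\<integral>\<^sup>+a. \<integral>\<^sup>+b. h f a b \<partial>count_space J \<partial>count_space J)" for f
  proof -
    have "?C f = (\<integral>\<^sup>+a. \<integral>\<^sup>+b. of_bool (f a \<le> f b) * (w b * \<tau> a) \<partial>count_space J \<partial>count_space J)"
      by (rule nn_integral_count_space_nn_integral) (use J in auto)
    then have "?C f + ?C f = ?C f + \<dots>"
      by simp
    also have "\<dots> = (\<integral>\<^sup>+a. \<integral>\<^sup>+b. h f a b \<partial>count_space J \<partial>count_space J)"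
      by (simp add: h_def nn_integral_add)
    finally show ?thesis .
  qed
  have "h pos a b \<le> h pos' a b" if ab: "a \<in> J" "b \<in> J" for a b
  proof (cases "a = b")
    case False
    then have ne: "pos a \<noteq> pos b" "pos' a \<noteq> pos' b"
      using inj ab by (auto dest: inj_onD)
    show ?thesis
      using ratio[OF ab] ratio[OF ab(2,1)] ne by (auto simp: h_def)
  qed (simp add: h_def)
  then have "?C pos + ?C pos \<le> ?C pos' + ?C pos'"
    unfolding double by (intro nn_integral_mono) auto
  then have "2 * ?C pos \<le> 2 * ?C pos'"
    by (simp add: mult_2)
  then show ?thesis
    by (subst (asm) ennreal_mult_le_mult_iff) auto
qed

section \<open>Expected search times\<close>

locale search_game =
  fixes n :: nat and t \<alpha> :: "nat \<Rightarrow> real"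
  assumes t_pos: "i \<in> {1..n} \<Longrightarrow> 0 < t i"
    and \<alpha>_pos: "i \<in> {1..n} \<Longrightarrow> 0 < \<alpha> i"
    and \<alpha>_less_1: "i \<in> {1..n} \<Longrightarrow> \<alpha> i < 1"
begin

section \<open>Search counts and a series for the expected times\<close>

lemma search_seqs_D: "\<xi> \<in> search_seqs n \<Longrightarrow> \<xi> s \<in> {1..n}"
  by (simp add: search_seqs_def)

lemma num_searches_0 [simp]: "num_searches \<xi> 0 i = 0"
  by (simp add: num_searches_def)

lemma num_searches_Suc:
  "num_searches \<xi> (Suc s) i = num_searches \<xi> s i + of_bool (\<xi> s = i)"
proof -
  have "{r. r < Suc s \<and> \<xi> r = i} = {r. r < s \<and> \<xi> r = i} \<union> (if \<xi> s = i then {s} else {})"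
    by (auto simp: less_Suc_eq)
  then show ?thesis
    by (simp add: num_searches_def)
qed

lemma num_searches_mono: "s \<le> s' \<Longrightarrow> num_searches \<xi> s i \<le> num_searches \<xi> s' i"
  unfolding num_searches_def by (rule card_mono) auto

lemma num_searches_enumerate:
  assumes "infinite {s. \<xi> s = i}"
  shows "num_searches \<xi> (Infinite_Set.enumerate {s. \<xi> s = i} r) i = r"
proof -
  let ?e = "Infinite_Set.enumerate {s. \<xi> s = i}"
  have "{x. x < ?e r \<and> \<xi> x = i} = ?e ` {..<r}"
  proof (intro equalityI subsetI)
    fix x assume "x \<in> {x. x < ?e r \<and> \<xi> x = i}"
    moreover from this obtain q where "?e q = x"
      using enumerate_Ex[OF assms, of x] by auto
    ultimately show "x \<in> ?e ` {..<r}"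
      using assms by auto
  next
    fix x assume "x \<in> ?e ` {..<r}"
    then show "x \<in> {x. x < ?e r \<and> \<xi> x = i}"
      using assms enumerate_in_set[OF assms] by auto
  qed
  moreover have "inj_on ?e {..<r}"
    using inj_enumerate[OF assms] by (rule inj_on_subset) simp
  ultimately show ?thesis
    by (simp add: num_searches_def card_image)
qed

text \<open>Turns the condition on stages in \<open>completion_time\<close> into a lower bound on
  the exponent of a geometric series.\<close>

lemma le_enumerate_iff:
  assumes "infinite {s. \<xi> s = i}"
  shows "s \<le> Infinite_Set.enumerate {s. \<xi> s = i} r \<longleftrightarrow> num_searches \<xi> s i \<le> r"
proof
  let ?e = "Infinite_Set.enumerate {s. \<xi> s = i}"
  show "s \<le> ?e r \<Longrightarrow> num_searches \<xi> s i \<le> r"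
    using num_searches_mono[of s "?e r" \<xi> i] num_searches_enumerate[OF assms, of r] by simp
  assume "num_searches \<xi> s i \<le> r"
  moreover have "r < num_searches \<xi> s i" if "?e r < s"
    using num_searches_mono[of "Suc (?e r)" s \<xi> i] that num_searches_enumerate[OF assms, of r]
      enumerate_in_set[OF assms, of r] by (simp add: num_searches_Suc)
  ultimately show "s \<le> ?e r"
    by (meson not_le)
qed

text \<open>With the hider in box \<open>i\<close>, stage \<open>s\<close> is reached exactly when
  all earlier searches of \<open>i\<close> have failed. Formally, the sums over stages and over
  detecting searches are exchanged.\<close>

lemma u_box_eq_suminf:
  assumes \<xi>: "\<xi> \<in> search_seqs n" and i: "i \<in> {1..n}"
  shows "u_box t \<alpha> i \<xi> = (\<Sum>s. ereal (t (\<xi> s) * (1 - \<alpha> i) ^ num_searches \<xi> s i))"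
proof (cases "infinite {s. \<xi> s = i}")
  case True
  let ?e = "Infinite_Set.enumerate {s. \<xi> s = i}"
  have t0: "0 \<le> t (\<xi> s)" for s
    using t_pos search_seqs_D[OF \<xi>] by (simp add: less_imp_le)
  have a0: "0 \<le> \<alpha> i * (1 - \<alpha> i) ^ r" for r
    using \<alpha>_pos[OF i] \<alpha>_less_1[OF i] by simp
  have expand: "ennreal (\<alpha> i * (1 - \<alpha> i) ^ r * completion_time t \<xi> i (Suc r)) =
      (\<integral>\<^sup>+s. ennreal (if s \<le> ?e r then \<alpha> i * (1 - \<alpha> i) ^ r * t (\<xi> s) else 0) \<partial>count_space UNIV)" for r
  proof -
    have "(\<integral>\<^sup>+s. ennreal (if s \<le> ?e r then \<alpha> i * (1 - \<alpha> i) ^ r * t (\<xi> s) else 0) \<partial>count_space UNIV) =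
        (\<Sum>s\<le>?e r. ennreal (if s \<le> ?e r then \<alpha> i * (1 - \<alpha> i) ^ r * t (\<xi> s) else 0))"
      by (rule nn_integral_count_space') auto
    also have "\<dots> = (\<Sum>s\<le>?e r. ennreal (\<alpha> i * (1 - \<alpha> i) ^ r * t (\<xi> s)))"
      by simp
    also have "\<dots> = ennreal (\<Sum>s\<le>?e r. \<alpha> i * (1 - \<alpha> i) ^ r * t (\<xi> s))"
      by (intro sum_ennreal mult_nonneg_nonneg[OF a0 t0])
    finally show ?thesis
      by (simp add: completion_time_def sum_distrib_left)
  qed
  have tail: "(\<integral>\<^sup>+r. ennreal (if s \<le> ?e r then \<alpha> i * (1 - \<alpha> i) ^ r * t (\<xi> s) else 0) \<partial>count_space UNIV) =
      ennreal (t (\<xi> s) * (1 - \<alpha> i) ^ num_searches \<xi> s i)" for s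
  proof -
    let ?f = "\<lambda>r. if num_searches \<xi> s i \<le> r then \<alpha> i * (1 - \<alpha> i) ^ r * t (\<xi> s) else 0"
    let ?c = "\<alpha> i * (1 - \<alpha> i) ^ num_searches \<xi> s i * t (\<xi> s)"
    \<comment> \<open>The geometric law has tail \<open>(1 - \<alpha> i) ^ m\<close> from index
      \<open>m\<close> on; shifting by \<open>m\<close> pulls out the constant
      \<open>?c\<close>.\<close>
    have "(\<lambda>r. ?c * (1 - \<alpha> i) ^ r) sums (?c * (1 / (1 - (1 - \<alpha> i))))"
      using \<alpha>_pos[OF i] \<alpha>_less_1[OF i] by (intro sums_mult geometric_sums) simp
    moreover have "(\<lambda>r. ?c * (1 - \<alpha> i) ^ r) = (\<lambda>r. ?f (r + num_searches \<xi> s i))"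
      by (simp add: fun_eq_iff power_add)
    moreover have "?c * (1 / (1 - (1 - \<alpha> i))) = t (\<xi> s) * (1 - \<alpha> i) ^ num_searches \<xi> s i"
      using \<alpha>_pos[OF i] by simp
    ultimately have "?f sums (t (\<xi> s) * (1 - \<alpha> i) ^ num_searches \<xi> s i)"
      by (subst sums_zero_iff_shift[symmetric, where n = "num_searches \<xi> s i"]) auto
    then have "(\<Sum>r. ennreal (?f r)) = ennreal (t (\<xi> s) * (1 - \<alpha> i) ^ num_searches \<xi> s i)"
      by (rule suminf_ennreal_eq[rotated]) (use a0 t0 in auto)
    then show ?thesis
      by (simp add: nn_integral_count_space_nat le_enumerate_iff[OF True])
  qed
  have "u_box t \<alpha> i \<xi> = (\<Sum>r. ereal (\<alpha> i * (1 - \<alpha> i) ^ r * completion_time t \<xi> i (Suc r)))"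
    using True by (simp add: u_box_def)
  also have "\<dots> = enn2ereal (\<integral>\<^sup>+r. ennreal (\<alpha> i * (1 - \<alpha> i) ^ r * completion_time t \<xi> i (Suc r)) \<partial>count_space UNIV)"
    by (intro suminf_ereal_eq_nn_integral mult_nonneg_nonneg[OF a0])
      (auto simp: completion_time_def intro!: sum_nonneg t0)
  also have "\<dots> = enn2ereal (\<integral>\<^sup>+s. \<integral>\<^sup>+r. ennreal (if s \<le> ?e r then \<alpha> i * (1 - \<alpha> i) ^ r * t (\<xi> s) else 0)
      \<partial>count_space UNIV \<partial>count_space UNIV)"
    unfolding expand by (subst nn_integral_count_space_nn_integral) auto
  also have "\<dots> = (\<Sum>s. ereal (t (\<xi> s) * (1 - \<alpha> i) ^ num_searches \<xi> s i))"
    unfolding tail using t0 \<alpha>_less_1[OF i] by (intro suminf_ereal_eq_nn_integral[symmetric]) simp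
  finally show ?thesis .
next
  case False
  \<comment> \<open>With only \<open>N\<close> searches of box \<open>i\<close>, every term is at
    least the shortest duration times \<open>(1 - \<alpha> i) ^ N\<close>, so the series diverges
    too.\<close>
  define N where "N = card {s. \<xi> s = i}"
  define \<tau> where "\<tau> = Min (t ` {1..n})"
  have "0 < \<tau>" and \<tau>: "\<And>j. j \<in> {1..n} \<Longrightarrow> \<tau> \<le> t j"
    using t_pos i by (auto simp: \<tau>_def Min_gr_iff)
  then have c: "0 < \<tau> * (1 - \<alpha> i) ^ N"
    using \<alpha>_less_1[OF i] by simp
  have le: "\<tau> * (1 - \<alpha> i) ^ N \<le> t (\<xi> s) * (1 - \<alpha> i) ^ num_searches \<xi> s i" for s
  proof (intro mult_mono power_decreasing \<tau> search_seqs_D[OF \<xi>])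
    show "num_searches \<xi> s i \<le> N"
      unfolding N_def num_searches_def using False by (intro card_mono) auto
    show "0 \<le> t (\<xi> s)"
      using t_pos[OF search_seqs_D[OF \<xi>]] by (simp add: less_imp_le)
  qed (use \<alpha>_less_1[OF i] \<alpha>_pos[OF i] in auto)
  have "(\<Sum>s. ereal (t (\<xi> s) * (1 - \<alpha> i) ^ num_searches \<xi> s i)) = \<infinity>"
  proof (rule ccontr)
    assume "(\<Sum>s. ereal (t (\<xi> s) * (1 - \<alpha> i) ^ num_searches \<xi> s i)) \<noteq> \<infinity>"
    then have "summable (\<lambda>s. t (\<xi> s) * (1 - \<alpha> i) ^ num_searches \<xi> s i)"
      using le c by (intro summable_ereal) (auto intro: order_trans[OF less_imp_le])
    then have "(\<lambda>s. t (\<xi> s) * (1 - \<alpha> i) ^ num_searches \<xi> s i) \<longlonglongrightarrow> 0"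
      by (rule summable_LIMSEQ_zero)
    then have "\<tau> * (1 - \<alpha> i) ^ N \<le> 0"
      by (rule LIMSEQ_le_const) (use le in auto)
    with c show False
      by simp
  qed
  then show ?thesis
    using False by (simp add: u_box_def)
qed

lemma u_box_nonneg': "\<xi> \<in> search_seqs n \<Longrightarrow> i \<in> {1..n} \<Longrightarrow> 0 \<le> u_box t \<alpha> i \<xi>"
  using t_pos \<alpha>_pos \<alpha>_less_1 by (intro u_box_nonneg[of _ n]) auto

text \<open>The probability that the first \<open>s\<close> searches all miss the hider.\<close>

definition undetected :: "(nat \<Rightarrow> real) \<Rightarrow> (nat \<Rightarrow> nat) \<Rightarrow> nat \<Rightarrow> real" where
  "undetected p \<xi> s = (\<Sum>i=1..n. p i * (1 - \<alpha> i) ^ num_searches \<xi> s i)"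

lemma hiding_nonneg: "p \<in> hiding_strategies n \<Longrightarrow> i \<in> {1..n} \<Longrightarrow> 0 \<le> p i"
  by (simp add: hiding_strategies_def)

lemma hiding_sum: "p \<in> hiding_strategies n \<Longrightarrow> (\<Sum>i=1..n. p i) = 1"
  by (simp add: hiding_strategies_def)

text \<open>Full support makes Gittins sequences return to every box forever and makes sequences
  that abandon a box infinitely costly.\<close>

definition positive_strategies :: "(nat \<Rightarrow> real) set" where
  "positive_strategies = {p \<in> hiding_strategies n. \<forall>i\<in>{1..n}. 0 < p i}"

lemma positive_hiding: "p \<in> positive_strategies \<Longrightarrow> p \<in> hiding_strategies n"
  by (simp add: positive_strategies_def)

lemma positive_pos: "p \<in> positive_strategies \<Longrightarrow> i \<in> {1..n} \<Longrightarrow> 0 < p i"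
  by (simp add: positive_strategies_def)

lemma undetected_nonneg:
  assumes "\<And>i. i \<in> {1..n} \<Longrightarrow> 0 \<le> p i"
  shows "0 \<le> undetected p \<xi> s"
  unfolding undetected_def
proof (rule sum_nonneg)
  fix i assume "i \<in> {1..n}"
  then show "0 \<le> p i * (1 - \<alpha> i) ^ num_searches \<xi> s i"
    using assms \<alpha>_less_1[of i] by simp
qed

lemma u_hide_eq_suminf:
  assumes \<xi>: "\<xi> \<in> search_seqs n" and p: "\<And>i. i \<in> {1..n} \<Longrightarrow> 0 \<le> p i"
  shows "u_hide n t \<alpha> p \<xi> = (\<Sum>s. ereal (t (\<xi> s) * undetected p \<xi> s))"
proof -
  have nn: "0 \<le> t (\<xi> s) * (1 - \<alpha> i) ^ num_searches \<xi> s i" if "i \<in> {1..n}" for i s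
    using t_pos[OF search_seqs_D[OF \<xi>, of s]] \<alpha>_less_1[OF that] by simp
  have "u_hide n t \<alpha> p \<xi> =
      (\<Sum>i=1..n. \<Sum>s. ereal (p i) * ereal (t (\<xi> s) * (1 - \<alpha> i) ^ num_searches \<xi> s i))"
    unfolding u_hide_def
    by (intro sum.cong refl) (use nn p in \<open>simp add: u_box_eq_suminf[OF \<xi>] suminf_cmult_ereal[symmetric] del: times_ereal.simps\<close>)
  also have "\<dots> = (\<Sum>s. \<Sum>i=1..n. ereal (p i) * ereal (t (\<xi> s) * (1 - \<alpha> i) ^ num_searches \<xi> s i))"
    by (rule suminf_sum_ereal[symmetric]) (use nn p in simp)
  also have "\<dots> = (\<Sum>s. ereal (t (\<xi> s) * undetected p \<xi> s))"
    by (simp add: undetected_def sum_distrib_left mult_ac)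
  finally show ?thesis .
qed

section \<open>Gittins sequences and the bound \<open>M\<close>\<close>

lemma gittins_seq_search_seqs: "gittins_seq n t \<alpha> p \<xi> \<Longrightarrow> \<xi> \<in> search_seqs n"
  by (auto simp: gittins_seq_def gittins_boxes_def search_seqs_def)

lemma gittins_seq_index_le:
  "gittins_seq n t \<alpha> p \<xi> \<Longrightarrow> i \<in> {1..n} \<Longrightarrow>
    gittins_index t \<alpha> p (num_searches \<xi> s) i \<le> gittins_index t \<alpha> p (num_searches \<xi> s) (\<xi> s)"
  by (auto simp: gittins_seq_def gittins_boxes_def)

lemma M_const_nonneg: "0 \<le> M_const n t \<alpha>"
  unfolding M_const_def using t_pos \<alpha>_pos by (intro sum_nonneg) (simp add: less_imp_le)

text \<open>
  Each search made by a Gittins sequence has an index at least \<open>P / M\<close>, where \<open>P\<close> is the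
  probability that the hider is still undetected; so the detection probability per unit time is
  at least \<open>P / M\<close>, and the total expected time is at most \<open>M\<close>.
\<close>

lemma gittins_u_hide_le_M:
  assumes p: "p \<in> hiding_strategies n" and G: "gittins_seq n t \<alpha> p \<xi>"
  shows "u_hide n t \<alpha> p \<xi> \<le> ereal (M_const n t \<alpha>)"
proof -
  note \<xi> = gittins_seq_search_seqs[OF G]
  \<comment> \<open>The probability of detection at stage \<open>s\<close>; these telescope to the
    loss in \<open>undetected\<close>.\<close>
  define d where "d s = p (\<xi> s) * (1 - \<alpha> (\<xi> s)) ^ num_searches \<xi> s (\<xi> s) * \<alpha> (\<xi> s)" for s
  have step: "undetected p \<xi> (Suc s) = undetected p \<xi> s - d s" for s
  proof -
    have "p i * (1 - \<alpha> i) ^ num_searches \<xi> (Suc s) i =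
        p i * (1 - \<alpha> i) ^ num_searches \<xi> s i - (if i = \<xi> s then d s else 0)" for i
      by (auto simp: num_searches_Suc d_def algebra_simps)
    then show ?thesis
      using search_seqs_D[OF \<xi>, of s] by (simp add: undetected_def sum_subtractf sum.delta)
  qed
  have d_sum: "(\<Sum>s<S. d s) = 1 - undetected p \<xi> S" for S
  proof (induction S)
    case 0
    then show ?case
      using hiding_sum[OF p] by (simp add: undetected_def)
  qed (simp add: step)
  have le: "t (\<xi> s) * undetected p \<xi> s \<le> M_const n t \<alpha> * d s" for s
  proof -
    have ts: "0 < t (\<xi> s)"
      using t_pos search_seqs_D[OF \<xi>] by simp
    have "t (\<xi> s) * (p i * (1 - \<alpha> i) ^ num_searches \<xi> s i) \<le> t i / \<alpha> i * d s" if i: "i \<in> {1..n}" for i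
      using gittins_seq_index_le[OF G i, of s] t_pos[OF i] \<alpha>_pos[OF i] ts
      by (simp add: gittins_index_def d_def field_simps)
    then show ?thesis
      unfolding undetected_def M_const_def sum_distrib_left sum_distrib_right by (rule sum_mono)
  qed
  have "(\<Sum>s<S. t (\<xi> s) * undetected p \<xi> s) \<le> M_const n t \<alpha>" for S
  proof -
    have "(\<Sum>s<S. t (\<xi> s) * undetected p \<xi> s) \<le> M_const n t \<alpha> * (\<Sum>s<S. d s)"
      unfolding sum_distrib_left by (rule sum_mono) (rule le)
    also have "\<dots> \<le> M_const n t \<alpha> * 1"
      unfolding d_sum using M_const_nonneg undetected_nonneg[OF hiding_nonneg[OF p]]
      by (intro mult_left_mono) auto
    finally show ?thesis
      by simp
  qed
  moreover have "0 \<le> t (\<xi> s) * undetected p \<xi> s" for s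
    using t_pos[OF search_seqs_D[OF \<xi>, of s]] undetected_nonneg[OF hiding_nonneg[OF p]] by simp
  ultimately show ?thesis
    by (subst u_hide_eq_suminf[OF \<xi> hiding_nonneg[OF p]]) (auto intro!: suminf_bound)
qed

lemma gittins_boxes_nonempty:
  assumes "1 \<le> n"
  shows "gittins_boxes n t \<alpha> p m \<noteq> {}"
proof -
  let ?I = "gittins_index t \<alpha> p m ` {1..n}"
  have "Max ?I \<in> ?I"
    using assms by (intro Max_in) auto
  then obtain j where "j \<in> {1..n}" "gittins_index t \<alpha> p m j = Max ?I"
    by auto
  then have "j \<in> gittins_boxes n t \<alpha> p m"
    by (simp add: gittins_boxes_def)
  then show ?thesis
    by auto
qed

lemma ex_gittins_seq:
  assumes "1 \<le> n"
  obtains \<xi> where "gittins_seq n t \<alpha> p \<xi>"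
proof -
  define next_box where "next_box m = (SOME j. j \<in> gittins_boxes n t \<alpha> p m)" for m
  have next_box: "next_box m \<in> gittins_boxes n t \<alpha> p m" for m
    unfolding next_box_def using gittins_boxes_nonempty[OF assms] by (simp add: some_in_eq)
  \<comment> \<open>A Gittins choice depends on the past only through the counts, so the recursion
    runs on count vectors.\<close>
  define count where "count = rec_nat (\<lambda>_. 0) (\<lambda>_ m. m(next_box m := Suc (m (next_box m))))"
  define \<xi> where "\<xi> s = next_box (count s)" for s
  have "num_searches \<xi> s = count s" for s
    by (induction s) (auto simp: fun_eq_iff num_searches_Suc count_def \<xi>_def)
  then have "gittins_seq n t \<alpha> p \<xi>"
    using next_box by (simp add: gittins_seq_def \<xi>_def)
  then show thesis
    by (rule that)
qed

lemma u_min_le_M: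
  assumes "1 \<le> n" "p \<in> hiding_strategies n"
  shows "u_min n t \<alpha> p \<le> ereal (M_const n t \<alpha>)"
proof -
  obtain \<xi> where G: "gittins_seq n t \<alpha> p \<xi>"
    using ex_gittins_seq[OF assms(1)] .
  have "u_min n t \<alpha> p \<le> u_hide n t \<alpha> p \<xi>"
    unfolding u_min_def by (rule INF_lower) (rule gittins_seq_search_seqs[OF G])
  also note gittins_u_hide_le_M[OF assms(2) G]
  finally show ?thesis .
qed

lemma u_box_le_u_hide:
  assumes "\<xi> \<in> search_seqs n" "i \<in> {1..n}" "\<And>i. i \<in> {1..n} \<Longrightarrow> 0 \<le> p i"
  shows "ereal (p i) * u_box t \<alpha> i \<xi> \<le> u_hide n t \<alpha> p \<xi>"
proof -
  have "(\<Sum>i\<in>{i}. ereal (p i) * u_box t \<alpha> i \<xi>) \<le> u_hide n t \<alpha> p \<xi>"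
    unfolding u_hide_def
    by (intro sum_mono2) (use assms u_box_nonneg'[OF assms(1)] in auto)
  then show ?thesis
    by simp
qed

text \<open>The share of box \<open>i\<close> in the total cost is at most \<open>M\<close>. Against
  full support all box costs are therefore finite, which later permits real arithmetic.\<close>

lemma gittins_u_box_le:
  assumes "p \<in> hiding_strategies n" "gittins_seq n t \<alpha> p \<xi>" "i \<in> {1..n}" "0 < p i"
  shows "u_box t \<alpha> i \<xi> \<le> ereal (M_const n t \<alpha> / p i)"
proof -
  have "ereal (p i) * u_box t \<alpha> i \<xi> \<le> u_hide n t \<alpha> p \<xi>"
    using assms(3) by (intro u_box_le_u_hide gittins_seq_search_seqs[OF assms(2)] hiding_nonneg[OF assms(1)])
  also note gittins_u_hide_le_M[OF assms(1,2)]
  finally have "ereal (p i) * u_box t \<alpha> i \<xi> \<le> ereal (M_const n t \<alpha>)" .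
  then show ?thesis
    using assms(4) by (cases "u_box t \<alpha> i \<xi>") (simp_all add: field_simps)
qed

section \<open>Optimality of Gittins sequences\<close>

text \<open>A job \<open>(i, r)\<close> is the search of box \<open>i\<close> that is preceded by \<open>r\<close> searches of box \<open>i\<close>.\<close>

definition jobs :: "(nat \<times> nat) set" where
  "jobs = {1..n} \<times> UNIV"

lemma nn_integral_jobs:
  "(\<integral>\<^sup>+a. f a \<partial>count_space jobs) = (\<Sum>i=1..n. \<integral>\<^sup>+r. f (i, r) \<partial>count_space UNIV)"
  unfolding jobs_def by (rule nn_integral_count_space_Times) simp

definition job_pos :: "(nat \<Rightarrow> nat) \<Rightarrow> nat \<times> nat \<Rightarrow> nat" where
  "job_pos \<xi> a = Infinite_Set.enumerate {s. \<xi> s = fst a} (snd a)"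

text \<open>The probability that job \<open>a\<close> is the one that finds the hider.\<close>

definition job_weight :: "(nat \<Rightarrow> real) \<Rightarrow> nat \<times> nat \<Rightarrow> real" where
  "job_weight p a = p (fst a) * \<alpha> (fst a) * (1 - \<alpha> (fst a)) ^ snd a"

definition searches_all :: "(nat \<Rightarrow> nat) \<Rightarrow> bool" where
  "searches_all \<xi> \<longleftrightarrow> \<xi> \<in> search_seqs n \<and> (\<forall>i\<in>{1..n}. infinite {s. \<xi> s = i})"

lemma searches_allD:
  assumes "searches_all \<xi>"
  shows "\<xi> \<in> search_seqs n" and "i \<in> {1..n} \<Longrightarrow> infinite {s. \<xi> s = i}"
  using assms by (auto simp: searches_all_def)

lemma box_at_job_pos: "searches_all \<xi> \<Longrightarrow> a \<in> jobs \<Longrightarrow> \<xi> (job_pos \<xi> a) = fst a"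
  using enumerate_in_set[OF searches_allD(2), of \<xi> "fst a" "snd a"]
  by (auto simp: jobs_def job_pos_def)

text \<open>Each stage carries out one job, so sums over stages become sums over a job set common to
  all these sequences.\<close>

lemma bij_betw_job_pos:
  assumes "searches_all \<xi>"
  shows "bij_betw (job_pos \<xi>) jobs UNIV"
proof -
  have "inj_on (job_pos \<xi>) jobs"
  proof (rule inj_onI)
    fix a b assume ab: "a \<in> jobs" "b \<in> jobs" "job_pos \<xi> a = job_pos \<xi> b"
    then have "fst a = fst b"
      using box_at_job_pos[OF assms] by metis
    moreover have inf: "infinite {s. \<xi> s = fst a}"
      using ab(1) by (intro searches_allD(2)[OF assms]) (auto simp: jobs_def)
    ultimately have "Infinite_Set.enumerate {s. \<xi> s = fst a} (snd a) = Infinite_Set.enumerate {s. \<xi> s = fst a} (snd b)"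
      using ab(3) by (simp add: job_pos_def)
    then have "snd a = snd b"
      by (rule injD[OF inj_enumerate[OF inf]])
    with \<open>fst a = fst b\<close> show "a = b"
      by (rule prod_eqI)
  qed
  moreover have "s \<in> job_pos \<xi> ` jobs" for s
  proof -
    have i: "\<xi> s \<in> {1..n}"
      by (rule search_seqs_D[OF searches_allD(1)[OF assms]])
    have "\<exists>r. Infinite_Set.enumerate {x. \<xi> x = \<xi> s} r = s"
      by (rule enumerate_Ex[OF searches_allD(2)[OF assms i]]) simp
    then obtain r where "job_pos \<xi> (\<xi> s, r) = s"
      by (auto simp: job_pos_def)
    moreover have "(\<xi> s, r) \<in> jobs"
      using i by (simp add: jobs_def)
    ultimately show ?thesis
      by (metis imageI)
  qed
  ultimately show ?thesis
    by (auto simp: bij_betw_def)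
qed

lemma completion_time_eq:
  assumes "searches_all \<xi>"
  shows "ennreal (completion_time t \<xi> i (Suc r)) =
    (\<integral>\<^sup>+b. of_bool (job_pos \<xi> b \<le> job_pos \<xi> (i, r)) * ennreal (t (fst b)) \<partial>count_space jobs)"
proof -
  let ?S = "job_pos \<xi> (i, r)"
  have t0: "0 \<le> t (\<xi> s)" for s
    using t_pos[OF search_seqs_D[OF searches_allD(1)[OF assms], of s]] by simp
  have "(\<integral>\<^sup>+b. of_bool (job_pos \<xi> b \<le> ?S) * ennreal (t (fst b)) \<partial>count_space jobs) =
      (\<integral>\<^sup>+b. of_bool (job_pos \<xi> b \<le> ?S) * ennreal (t (\<xi> (job_pos \<xi> b))) \<partial>count_space jobs)"
    by (intro nn_integral_cong) (simp add: box_at_job_pos[OF assms])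
  also have "\<dots> = (\<integral>\<^sup>+s. of_bool (s \<le> ?S) * ennreal (t (\<xi> s)) \<partial>count_space UNIV)"
    by (rule nn_integral_bij_count_space[OF bij_betw_job_pos[OF assms]])
  also have "\<dots> = (\<Sum>s\<le>?S. of_bool (s \<le> ?S) * ennreal (t (\<xi> s)))"
    by (rule nn_integral_count_space') auto
  also have "\<dots> = ennreal (\<Sum>s\<le>?S. t (\<xi> s))"
    using t0 by (simp add: sum_ennreal)
  finally show ?thesis
    by (simp add: completion_time_def job_pos_def)
qed

text \<open>A job is completed once it and all jobs before it are done. This is the form of
  \<open>smith_rule\<close>: only the positions depend on \<open>\<xi>\<close>.\<close>

lemma u_hide_eq_pairs:
  assumes all: "searches_all \<xi>" and p: "\<And>i. i \<in> {1..n} \<Longrightarrow> 0 \<le> p i"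
  shows "u_hide n t \<alpha> p \<xi> = enn2ereal (\<integral>\<^sup>+a. \<integral>\<^sup>+b. of_bool (job_pos \<xi> b \<le> job_pos \<xi> a) *
    (ennreal (job_weight p a) * ennreal (t (fst b))) \<partial>count_space jobs \<partial>count_space jobs)"
proof -
  have c0: "0 \<le> completion_time t \<xi> i r" for i r
    unfolding completion_time_def
    using t_pos[OF search_seqs_D[OF searches_allD(1)[OF all]]] by (intro sum_nonneg less_imp_le) auto
  have "ereal (p i) * u_box t \<alpha> i \<xi> = enn2ereal (\<integral>\<^sup>+r. \<integral>\<^sup>+b. of_bool (job_pos \<xi> b \<le> job_pos \<xi> (i, r)) *
      (ennreal (job_weight p (i, r)) * ennreal (t (fst b))) \<partial>count_space jobs \<partial>count_space UNIV)"
    if i: "i \<in> {1..n}" for i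
  proof -
    have a0: "0 \<le> \<alpha> i * (1 - \<alpha> i) ^ r" for r
      using \<alpha>_pos[OF i] \<alpha>_less_1[OF i] by simp
    have weight: "ennreal (p i) * ennreal (\<alpha> i * (1 - \<alpha> i) ^ r * completion_time t \<xi> i (Suc r)) =
        ennreal (job_weight p (i, r)) * ennreal (completion_time t \<xi> i (Suc r))" for r
      using p[OF i] a0[of r] c0[of i "Suc r"]
      by (simp add: job_weight_def mult.assoc flip: ennreal_mult ennreal_mult')
    have "u_box t \<alpha> i \<xi> =
        enn2ereal (\<integral>\<^sup>+r. ennreal (\<alpha> i * (1 - \<alpha> i) ^ r * completion_time t \<xi> i (Suc r)) \<partial>count_space UNIV)"
      using searches_allD(2)[OF all i] mult_nonneg_nonneg[OF a0 c0]
      by (simp add: u_box_def suminf_ereal_eq_nn_integral)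
    moreover have "ereal (p i) = enn2ereal (ennreal (p i))"
      using p[OF i] by (simp add: enn2ereal_ennreal)
    ultimately have "ereal (p i) * u_box t \<alpha> i \<xi> = enn2ereal (ennreal (p i) *
        (\<integral>\<^sup>+r. ennreal (\<alpha> i * (1 - \<alpha> i) ^ r * completion_time t \<xi> i (Suc r)) \<partial>count_space UNIV))"
      by (simp only: times_ennreal.rep_eq)
    also have "\<dots> = enn2ereal (\<integral>\<^sup>+r. ennreal (job_weight p (i, r)) *
        ennreal (completion_time t \<xi> i (Suc r)) \<partial>count_space UNIV)"
      by (subst nn_integral_cmult[symmetric]) (simp_all only: weight borel_measurable_count_space)
    finally show ?thesis
      unfolding completion_time_eq[OF all] by (simp add: nn_integral_cmult[symmetric] mult.left_commute)
  qed
  then have "u_hide n t \<alpha> p \<xi> = (\<Sum>i=1..n. enn2ereal (\<integral>\<^sup>+r. \<integral>\<^sup>+b. of_bool (job_pos \<xi> b \<le> job_pos \<xi> (i, r)) *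
      (ennreal (job_weight p (i, r)) * ennreal (t (fst b))) \<partial>count_space jobs \<partial>count_space UNIV))"
    unfolding u_hide_def by (intro sum.cong refl)
  also have "\<dots> = enn2ereal (\<Sum>i=1..n. \<integral>\<^sup>+r. \<integral>\<^sup>+b. of_bool (job_pos \<xi> b \<le> job_pos \<xi> (i, r)) *
      (ennreal (job_weight p (i, r)) * ennreal (t (fst b))) \<partial>count_space jobs \<partial>count_space UNIV)"
    by (rule sum_enn2ereal) simp
  also have "\<dots> = enn2ereal (\<integral>\<^sup>+a. \<integral>\<^sup>+b. of_bool (job_pos \<xi> b \<le> job_pos \<xi> a) *
      (ennreal (job_weight p a) * ennreal (t (fst b))) \<partial>count_space jobs \<partial>count_space jobs)"
    by (subst (2) nn_integral_jobs) (rule refl)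
  finally show ?thesis .
qed

text \<open>Along a Gittins sequence the ratio of weight to duration never increases, as
  \<open>smith_rule\<close> demands. A rival that abandons a box has infinite cost.\<close>

lemma gittins_optimal:
  assumes p: "p \<in> positive_strategies"
    and G: "gittins_seq n t \<alpha> p \<xi>" and \<zeta>: "\<zeta> \<in> search_seqs n"
  shows "u_hide n t \<alpha> p \<xi> \<le> u_hide n t \<alpha> p \<zeta>"
proof (cases "searches_all \<zeta>")
  case True
  have "infinite {s. \<xi> s = i}" if i: "i \<in> {1..n}" for i
    using gittins_u_box_le[OF positive_hiding[OF p] G i positive_pos[OF p i]] by (auto simp: u_box_def split: if_splits)
  then have all: "searches_all \<xi>"
    using gittins_seq_search_seqs[OF G] by (simp add: searches_all_def)
  have ratio: "ennreal (job_weight p a) * ennreal (t (fst b)) \<le> ennreal (job_weight p b) * ennreal (t (fst a))"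
    if ab: "a \<in> jobs" "b \<in> jobs" and le: "job_pos \<xi> b \<le> job_pos \<xi> a" for a b
  proof -
    obtain i r j q where eq: "a = (i, r)" "b = (j, q)"
      by (cases a, cases b)
    let ?s = "job_pos \<xi> b"
    have i: "i \<in> {1..n}" and j: "j \<in> {1..n}"
      using ab eq by (auto simp: jobs_def)
    have \<xi>_s: "\<xi> ?s = j"
      using box_at_job_pos[OF all ab(2)] eq by simp
    have num: "num_searches \<xi> ?s j = q"
      using num_searches_enumerate[OF searches_allD(2)[OF all j]] eq by (simp add: job_pos_def)
    \<comment> \<open>Job \<open>a\<close> is not done before the stage of \<open>b\<close>, so the
      index of box \<open>i\<close> at that stage is at least the index of \<open>a\<close>.\<close>
    have "num_searches \<xi> ?s i \<le> r"
      using le eq le_enumerate_iff[OF searches_allD(2)[OF all i]] by (simp add: job_pos_def)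
    then have "p i * (1 - \<alpha> i) ^ r * \<alpha> i / t i \<le> p i * (1 - \<alpha> i) ^ num_searches \<xi> ?s i * \<alpha> i / t i"
      using positive_pos[OF p i] \<alpha>_pos[OF i] \<alpha>_less_1[OF i] t_pos[OF i]
      by (intro divide_right_mono mult_right_mono mult_left_mono power_decreasing) auto
    also have "\<dots> \<le> p j * (1 - \<alpha> j) ^ q * \<alpha> j / t j"
      using gittins_seq_index_le[OF G i, of ?s] by (simp add: gittins_index_def \<xi>_s num)
    finally have "job_weight p a * t j \<le> job_weight p b * t i"
      using t_pos[OF i] t_pos[OF j] by (simp add: job_weight_def eq field_simps)
    then show ?thesis
      using t_pos[OF i] t_pos[OF j] by (simp add: eq ennreal_mult''[symmetric] ennreal_leI)
  qed
  have "countable jobs"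
    by (simp add: jobs_def)
  note smith_rule[OF this bij_betw_imp_inj_on[OF bij_betw_job_pos[OF all]]
      bij_betw_imp_inj_on[OF bij_betw_job_pos[OF True]] ratio]
  moreover have p0: "\<And>i. i \<in> {1..n} \<Longrightarrow> 0 \<le> p i"
    using positive_pos[OF p] by (simp add: less_imp_le)
  ultimately show ?thesis
    by (simp only: u_hide_eq_pairs[OF all p0] u_hide_eq_pairs[OF True p0] less_eq_ennreal.rep_eq)
next
  case False
  then obtain i where i: "i \<in> {1..n}" "u_box t \<alpha> i \<zeta> = \<infinity>"
    using \<zeta> by (auto simp: u_box_def searches_all_def)
  then have "u_hide n t \<alpha> p \<zeta> = \<infinity>"
    using u_box_le_u_hide[OF \<zeta> i(1), of p] hiding_nonneg[OF positive_hiding[OF p]] positive_pos[OF p i(1)] by simp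
  then show ?thesis
    by simp
qed

lemma gittins_u_hide_eq_u_min:
  assumes "p \<in> positive_strategies" "gittins_seq n t \<alpha> p \<xi>"
  shows "u_hide n t \<alpha> p \<xi> = u_min n t \<alpha> p"
  unfolding u_min_def
  by (intro antisym INF_greatest INF_lower gittins_seq_search_seqs) (use assms in \<open>auto intro: gittins_optimal\<close>)

text \<open>Below \<eta>, some other box \<open>j\<close> keeps an index above that of the
  unsearched box \<open>i\<close> through \<open>m_const n t \<alpha> j\<close> searches, which
  alone take time at least \<open>M\<close>.\<close>

lemma gittins_u_box_ge_M:
  assumes p: "p \<in> hiding_strategies n" and G: "gittins_seq n t \<alpha> p \<xi>"
    and i: "i \<in> {1..n}" and less: "p i < \<eta>_const n t \<alpha> i"
  shows "ereal (M_const n t \<alpha>) \<le> u_box t \<alpha> i \<xi>"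
proof (cases "\<exists>s. \<xi> s = i")
  case False
  then show ?thesis
    by (auto simp: u_box_def)
next
  case True
  note \<xi> = gittins_seq_search_seqs[OF G]
  let ?m = "m_const n t \<alpha>"
  have "0 \<le> c_const n t \<alpha> i"
    unfolding c_const_def
  proof (rule sum_nonneg)
    fix j assume "j \<in> {1..n} - {i}"
    then show "0 \<le> t j / (\<alpha> j * (1 - \<alpha> j) ^ (?m j - 1))"
      using t_pos[of j] \<alpha>_pos[of j] \<alpha>_less_1[of j] by simp
  qed
  moreover have "0 < t i / \<alpha> i"
    using t_pos[OF i] \<alpha>_pos[OF i] by simp
  \<comment> \<open>Clearing the denominator of \<eta> leaves a strict inequality between two sums
    over the other boxes, so it is strict in some term \<open>j\<close>.\<close>
  ultimately have "p i * (t i / \<alpha> i + c_const n t \<alpha> i) < t i / \<alpha> i"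
    using less unfolding \<eta>_const_def by (subst (asm) pos_less_divide_eq) simp_all
  then have "p i * c_const n t \<alpha> i < (1 - p i) * (t i / \<alpha> i)"
    unfolding left_diff_distrib distrib_left by linarith
  moreover have "1 - p i = (\<Sum>j\<in>{1..n} - {i}. p j)"
    using hiding_sum[OF p] sum.remove[OF finite_atLeastAtMost i, of p] by linarith
  ultimately have "(\<Sum>j\<in>{1..n} - {i}. p i * (t j / (\<alpha> j * (1 - \<alpha> j) ^ (?m j - 1)))) <
      (\<Sum>j\<in>{1..n} - {i}. p j * (t i / \<alpha> i))"
    by (simp only: c_const_def sum_distrib_left sum_distrib_right)
  then have "\<not> (\<forall>j\<in>{1..n} - {i}. p j * (t i / \<alpha> i) \<le> p i * (t j / (\<alpha> j * (1 - \<alpha> j) ^ (?m j - 1))))"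
    using sum_mono by (meson not_le)
  then obtain j where j: "j \<in> {1..n}"
    and *: "p i * (t j / (\<alpha> j * (1 - \<alpha> j) ^ (?m j - 1))) < p j * (t i / \<alpha> i)"
    by (metis DiffD1 not_le)
  define S where "S = (LEAST s. \<xi> s = i)"
  have S: "\<xi> S = i" and before: "s < S \<Longrightarrow> \<xi> s \<noteq> i" for s
    using True by (auto simp: S_def intro: LeastI dest: not_less_Least)
  then have zero: "num_searches \<xi> s i = 0" if "s \<le> S" for s
    using that by (force simp: num_searches_def)
  \<comment> \<open>Otherwise, at the first search of \<open>i\<close>, the index of
    \<open>j\<close> would be at least its value after \<open>?m j - 1\<close> searches, hence above
    that of \<open>i\<close>.\<close>
  have many: "?m j \<le> num_searches \<xi> S j"
  proof (rule ccontr)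
    assume "\<not> ?m j \<le> num_searches \<xi> S j"
    then have "p j * (1 - \<alpha> j) ^ (?m j - 1) * \<alpha> j / t j \<le> p j * (1 - \<alpha> j) ^ num_searches \<xi> S j * \<alpha> j / t j"
      using hiding_nonneg[OF p j] \<alpha>_pos[OF j] \<alpha>_less_1[OF j] t_pos[OF j]
      by (intro divide_right_mono mult_right_mono mult_left_mono power_decreasing) auto
    also have "\<dots> \<le> p i * \<alpha> i / t i"
      using gittins_seq_index_le[OF G j, of S] by (simp add: gittins_index_def S zero)
    finally show False
      using * t_pos[OF i] t_pos[OF j] \<alpha>_pos[OF i] \<alpha>_pos[OF j] \<alpha>_less_1[OF j]
      by (simp add: field_simps)
  qed
  have t0: "0 \<le> t (\<xi> s)" for s
    using t_pos[OF search_seqs_D[OF \<xi>, of s]] by simp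
  have "M_const n t \<alpha> / t j \<le> real (?m j)"
    unfolding m_const_def by linarith
  then have "M_const n t \<alpha> \<le> real (?m j) * t j"
    using t_pos[OF j] by (simp add: pos_divide_le_eq)
  also have "\<dots> \<le> real (num_searches \<xi> S j) * t j"
    using many t_pos[OF j] by simp
  also have "\<dots> = (\<Sum>s\<in>{s. s < S \<and> \<xi> s = j}. t (\<xi> s))"
    by (simp add: num_searches_def)
  also have "\<dots> \<le> (\<Sum>s<S. t (\<xi> s))"
    using t0 by (intro sum_mono2) auto
  \<comment> \<open>Up to stage \<open>S\<close> no search of \<open>i\<close> has been made, so all
    factors are 1.\<close>
  also have "\<dots> = (\<Sum>s<S. t (\<xi> s) * (1 - \<alpha> i) ^ num_searches \<xi> s i)"
    by (simp add: zero)
  finally have "ereal (M_const n t \<alpha>) \<le> (\<Sum>s<S. ereal (t (\<xi> s) * (1 - \<alpha> i) ^ num_searches \<xi> s i))"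
    by simp
  also have "\<dots> \<le> (\<Sum>s. ereal (t (\<xi> s) * (1 - \<alpha> i) ^ num_searches \<xi> s i))"
    using t0 \<alpha>_less_1[OF i] by (intro suminf_upper) simp
  finally show ?thesis
    by (simp add: u_box_eq_suminf[OF \<xi> i])
qed

end

section \<open>Approachability\<close>

text \<open>If the response answers the positive part of the running sum, the cross term in the
  expanded square is nonpositive, and each round adds at most \<open>C\<close>.\<close>

lemma sum_max_0_power2_add_le:
  fixes x :: "'d \<Rightarrow> 'i \<Rightarrow> real"
  assumes le: "\<forall>d\<in>D. (\<Sum>i\<in>I. (x d i)\<^sup>2) \<le> C"
    and response: "\<forall>w. (\<forall>i\<in>I. 0 \<le> w i) \<longrightarrow> (\<exists>d\<in>D. (\<Sum>i\<in>I. w i * x d i) \<le> 0)"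
  shows "\<exists>ds. length ds = m \<and> set ds \<subseteq> D \<and> (\<Sum>i\<in>I. (max 0 (\<Sum>d\<leftarrow>ds. x d i))\<^sup>2) \<le> real m * C"
proof (induction m)
  case (Suc m)
  then obtain ds where ds: "length ds = m" "set ds \<subseteq> D"
    "(\<Sum>i\<in>I. (max 0 (\<Sum>d\<leftarrow>ds. x d i))\<^sup>2) \<le> real m * C"
    by blast
  define w where "w i = max 0 (\<Sum>d\<leftarrow>ds. x d i)" for i
  obtain d where d: "d \<in> D" "(\<Sum>i\<in>I. w i * x d i) \<le> 0"
    using response[rule_format, of w] by (auto simp: w_def)
  have "(max 0 (x d i + (\<Sum>d\<leftarrow>ds. x d i)))\<^sup>2 \<le> (w i + x d i)\<^sup>2" for i
  proof (cases "0 \<le> x d i + (\<Sum>d\<leftarrow>ds. x d i)")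
    case True
    then show ?thesis
      by (intro power_mono) (auto simp: w_def)
  qed (simp add: max_def)
  then have "(\<Sum>i\<in>I. (max 0 (x d i + (\<Sum>d\<leftarrow>ds. x d i)))\<^sup>2) \<le> (\<Sum>i\<in>I. (w i + x d i)\<^sup>2)"
    by (intro sum_mono)
  also have "\<dots> = (\<Sum>i\<in>I. (w i)\<^sup>2) + (\<Sum>i\<in>I. (x d i)\<^sup>2) + 2 * (\<Sum>i\<in>I. w i * x d i)"
    by (simp add: power2_sum sum.distrib sum_distrib_left mult.assoc)
  also have "\<dots> \<le> real m * C + C + 0"
    using ds(3) bspec[OF le d(1)] d(2) by (intro add_mono) (auto simp: w_def)
  finally show ?case
    using ds d(1) by (intro exI[of _ "d # ds"]) (simp add: algebra_simps)
qed simp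

text \<open>
  The orthant is approachable because always answering the positive part of the cumulative payoff
  vector keeps its squared norm at most linear in the number of rounds.
\<close>

lemma blackwell_approachability:
  fixes x :: "'d \<Rightarrow> 'i \<Rightarrow> real"
  assumes I: "finite I" and le: "\<forall>d\<in>D. (\<Sum>i\<in>I. (x d i)\<^sup>2) \<le> C"
    and response: "\<forall>w. (\<forall>i\<in>I. 0 \<le> w i) \<longrightarrow> (\<exists>d\<in>D. (\<Sum>i\<in>I. w i * x d i) \<le> 0)"
    and e: "0 < e"
  obtains \<theta> where "finite (set_pmf \<theta>)" "set_pmf \<theta> \<subseteq> D"
    "\<And>i. i \<in> I \<Longrightarrow> measure_pmf.expectation \<theta> (\<lambda>d. x d i) \<le> e"
proof -
  \<comment> \<open>Enough rounds that the average excess, at most the square root of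
    \<open>C / m\<close>, is below \<open>e\<close>.\<close>
  obtain m0 :: nat where m0: "C / e\<^sup>2 < real m0"
    using reals_Archimedean2 by blast
  define m where "m = Suc m0"
  have "0 < real m" "C < real m * e\<^sup>2"
    using m0 e by (auto simp: m_def field_simps intro: less_trans)
  obtain ds where ds: "length ds = m" "set ds \<subseteq> D"
    "(\<Sum>i\<in>I. (max 0 (\<Sum>d\<leftarrow>ds. x d i))\<^sup>2) \<le> real m * C"
    using sum_max_0_power2_add_le[OF le response, of m] by blast
  \<comment> \<open>The empirical mixture: a uniformly drawn round, so that repeated responses count
    with multiplicity.\<close>
  define \<theta> where "\<theta> = map_pmf (nth ds) (pmf_of_set {..<m})"
  have ne: "{..<m} \<noteq> {}"
    by (auto simp: m_def)
  then have set: "set_pmf \<theta> = set ds"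
    using ds(1) by (auto simp: \<theta>_def set_conv_nth)
  have "measure_pmf.expectation \<theta> (\<lambda>d. x d i) \<le> e" if i: "i \<in> I" for i
  proof -
    let ?S = "\<Sum>d\<leftarrow>ds. x d i"
    have "(max 0 ?S)\<^sup>2 \<le> (\<Sum>i\<in>I. (max 0 (\<Sum>d\<leftarrow>ds. x d i))\<^sup>2)"
      using I i by (intro member_le_sum) auto
    also have "\<dots> \<le> real m * C"
      by (rule ds(3))
    also have "\<dots> \<le> real m * (real m * e\<^sup>2)"
      using \<open>C < real m * e\<^sup>2\<close> by (intro mult_left_mono) auto
    also have "\<dots> = (real m * e)\<^sup>2"
      by (simp add: power2_eq_square)
    finally have "max 0 ?S \<le> real m * e"
      by (rule power2_le_imp_le) (use e in simp)
    then have "?S / real m \<le> e"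
      using \<open>0 < real m\<close> by (simp add: pos_divide_le_eq mult.commute)
    moreover have "measure_pmf.expectation \<theta> (\<lambda>d. x d i) = (\<Sum>s<m. x (ds ! s) i) / real m"
      using ne by (simp add: \<theta>_def integral_pmf_of_set)
    moreover have "(\<Sum>s<m. x (ds ! s) i) = ?S"
      using ds(1) by (simp add: sum_list_sum_nth atLeast0LessThan)
    ultimately show ?thesis
      by simp
  qed
  then show thesis
    using set ds(2) by (intro that[of \<theta>]) auto
qed

lemma ex_convex_step:
  fixes p \<delta> :: "'i \<Rightarrow> real"
  assumes I: "finite I" "I \<noteq> {}" and \<delta>: "\<And>i. i \<in> I \<Longrightarrow> \<delta> i < p i"
    and p: "\<And>i. i \<in> I \<Longrightarrow> 0 \<le> p i" "\<And>i. i \<in> I \<Longrightarrow> p i \<le> 1"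
  obtains s where "0 < s" "s < 1" "\<And>i. i \<in> I \<Longrightarrow> \<delta> i \<le> (1 - s) * p i"
proof -
  \<comment> \<open>The least slack, capped at 1/2; scaling by \<open>1 - s\<close> loses at most
    \<open>s\<close> because \<open>p i\<close> is at most 1.\<close>
  define s where "s = Min (insert (1/2) ((\<lambda>i. p i - \<delta> i) ` I))"
  have s: "0 < s" "s < 1"
    using I \<delta> by (auto simp: s_def Min_less_iff)
  have "\<delta> i \<le> (1 - s) * p i" if i: "i \<in> I" for i
  proof -
    have "s \<le> p i - \<delta> i"
      unfolding s_def using I i by (intro Min_le) auto
    moreover have "s * p i \<le> s * 1"
      using s p(2)[OF i] by (intro mult_left_mono) auto
    ultimately show ?thesis
      by (simp add: algebra_simps)
  qed
  with s show thesis
    by (rule that)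
qed

section \<open>The algorithm\<close>

context search_game begin

lemma u_hide_eq_real:
  assumes "\<And>i. i \<in> {1..n} \<Longrightarrow> u_box t \<alpha> i \<xi> = ereal (x i)"
  shows "u_hide n t \<alpha> p \<xi> = ereal (\<Sum>i=1..n. p i * x i)"
proof -
  have "u_hide n t \<alpha> p \<xi> = (\<Sum>i=1..n. ereal (p i * x i))"
    unfolding u_hide_def by (intro sum.cong refl) (simp add: assms)
  then show ?thesis
    by simp
qed

lemma u_min_nonneg:
  assumes "p \<in> hiding_strategies n"
  shows "0 \<le> u_min n t \<alpha> p"
  unfolding u_min_def u_hide_def
  using hiding_nonneg[OF assms] u_box_nonneg' by (intro INF_greatest sum_nonneg mult_nonneg_nonneg) auto

lemma u_min_eq_real:
  assumes "1 \<le> n" "p \<in> hiding_strategies n"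
  obtains y where "u_min n t \<alpha> p = ereal y" "y \<le> M_const n t \<alpha>"
  using u_min_nonneg[OF assms(2)] u_min_le_M[OF assms] by (cases "u_min n t \<alpha> p") auto

end

locale bounded_search_game = search_game +
  fixes \<delta> :: "nat \<Rightarrow> real"
  assumes n_ge_1: "1 \<le> n"
    and \<delta>_pos: "i \<in> {1..n} \<Longrightarrow> 0 < \<delta> i"
    and \<delta>_less: "i \<in> {1..n} \<Longrightarrow> \<delta> i < \<eta>_const n t \<alpha> i"
begin

section \<open>The upper bound on the value\<close>

lemma restricted_positive:
  assumes "p \<in> restricted_strategies n \<delta>"
  shows "p \<in> positive_strategies"
proof -
  have "0 < p i" if "i \<in> {1..n}" for i
    using assms \<delta>_pos[OF that] that by (auto simp: restricted_strategies_def intro: less_le_trans)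
  then show ?thesis
    using assms by (simp add: positive_strategies_def hiding_strategies_def restricted_strategies_def less_imp_le)
qed

text \<open>
  Scaling \<open>p\<close> down to \<open>(1 - s) p\<close> and topping it up to \<open>q = max ((1 - s) p) \<delta>\<close> adds mass only to
  boxes where \<open>q = \<delta> < \<eta>\<close>. A Gittins sequence against \<open>q\<close> takes time at least \<open>M\<close> to find the hider there,
  whereas \<open>u(p) \<le> M\<close>, so the hider does not lose.
\<close>

lemma ex_restricted_u_min_ge:
  assumes sum_\<delta>: "(\<Sum>i=1..n. \<delta> i) \<le> 1" and p: "p \<in> hiding_strategies n"
  obtains q where "q \<in> restricted_strategies n \<delta>" "u_min n t \<alpha> p \<le> u_min n t \<alpha> q"
proof -
  let ?M = "M_const n t \<alpha>"
  \<comment> \<open>The mass after scaling and topping up. It is at least 1 at \<open>s = 0\<close>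
    and at most 1 at \<open>s = 1\<close>, so some \<open>s\<close> gives exactly 1.\<close>
  define g where "g s = (\<Sum>i=1..n. max ((1 - s) * p i) (\<delta> i))" for s :: real
  have "g 1 \<le> 1"
  proof -
    have "g 1 = (\<Sum>i=1..n. \<delta> i)"
      unfolding g_def using \<delta>_pos by (intro sum.cong refl) (simp add: max_def not_le less_imp_le)
    then show ?thesis
      using sum_\<delta> by simp
  qed
  moreover have "1 \<le> g 0"
  proof -
    have "(\<Sum>i=1..n. p i) \<le> g 0"
      unfolding g_def by (intro sum_mono) simp
    then show ?thesis
      using hiding_sum[OF p] by simp
  qed
  moreover have "continuous_on {0..1} g"
    unfolding g_def by (intro continuous_intros)
  ultimately obtain s where s: "0 \<le> s" "s \<le> 1" "g s = 1"
    using IVT2'[of g 1 1 0] by auto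
  define q where "q i = max ((1 - s) * p i) (\<delta> i)" for i
  have q: "q \<in> restricted_strategies n \<delta>"
    using s(3) by (simp add: restricted_strategies_def q_def g_def)
  note q_pos = restricted_positive[OF q]
  note q_hiding = positive_hiding[OF q_pos]
  obtain \<xi> where G: "gittins_seq n t \<alpha> q \<xi>"
    using ex_gittins_seq[OF n_ge_1] .
  note \<xi> = gittins_seq_search_seqs[OF G]
  define x where "x i = real_of_ereal (u_box t \<alpha> i \<xi>)" for i
  have x: "u_box t \<alpha> i \<xi> = ereal (x i)" if i: "i \<in> {1..n}" for i
    using gittins_u_box_le[OF q_hiding G i positive_pos[OF q_pos i]] u_box_nonneg'[OF \<xi> i]
    by (cases "u_box t \<alpha> i \<xi>") (auto simp: x_def)
  obtain y where y: "u_min n t \<alpha> p = ereal y" "y \<le> ?M"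
    using u_min_eq_real[OF n_ge_1 p] .
  have "ereal y \<le> u_hide n t \<alpha> p \<xi>"
    unfolding y(1)[symmetric] u_min_def using \<xi> by (rule INF_lower)
  then have y_le: "y \<le> (\<Sum>i=1..n. p i * x i)"
    using u_hide_eq_real[of \<xi> x p] x by simp
  have "(1 - s) * (p i * x i) + (q i - (1 - s) * p i) * ?M \<le> q i * x i" if i: "i \<in> {1..n}" for i
  proof (cases "q i = (1 - s) * p i")
    case False
    then have "q i = \<delta> i"
      by (auto simp: q_def max_def split: if_splits)
    then have "?M \<le> x i"
      using gittins_u_box_ge_M[OF q_hiding G i] \<delta>_less[OF i] x[OF i] by simp
    then have "(q i - (1 - s) * p i) * ?M \<le> (q i - (1 - s) * p i) * x i"
      by (intro mult_left_mono) (auto simp: q_def)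
    then show ?thesis
      by (simp add: algebra_simps)
  qed simp
  then have "(\<Sum>i=1..n. (1 - s) * (p i * x i) + (q i - (1 - s) * p i) * ?M) \<le> (\<Sum>i=1..n. q i * x i)"
    by (rule sum_mono)
  moreover have "(\<Sum>i=1..n. (1 - s) * (p i * x i) + (q i - (1 - s) * p i) * ?M) =
      (1 - s) * (\<Sum>i=1..n. p i * x i) + s * ?M"
  proof -
    have "(\<Sum>i=1..n. q i - (1 - s) * p i) = s"
      using hiding_sum[OF p] hiding_sum[OF q_hiding] by (simp add: sum_subtractf flip: sum_distrib_left)
    then show ?thesis
      by (simp add: sum.distrib flip: sum_distrib_left sum_distrib_right)
  qed
  \<comment> \<open>Both the kept mass \<open>1 - s\<close> and the added mass \<open>s\<close> are
    worth at least \<open>y\<close> per unit.\<close>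
  moreover have "(1 - s) * y + s * y \<le> (1 - s) * (\<Sum>i=1..n. p i * x i) + s * ?M"
    using s y(2) y_le by (intro add_mono mult_left_mono) auto
  ultimately have "y \<le> (\<Sum>i=1..n. q i * x i)"
    by (simp add: algebra_simps)
  then have "u_min n t \<alpha> p \<le> u_hide n t \<alpha> q \<xi>"
    using u_hide_eq_real[of \<xi> x q] x y(1) by simp
  also have "\<dots> = u_min n t \<alpha> q"
    using gittins_u_hide_eq_u_min[OF q_pos G] .
  finally show thesis
    by (rule that[OF q])
qed

text \<open>The LP only has constraints from sequences in \<open>D\<close>, so \<open>u_min\<close>
  at a restricted strategy is a feasible objective value.\<close>

lemma game_value_le_lp:
  assumes D: "D \<subseteq> search_seqs n" and lp: "lp_optimal n t \<alpha> \<delta> D p v"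
  shows "game_value n t \<alpha> \<le> ereal v"
  unfolding game_value_def
proof (rule SUP_least)
  fix p' assume p': "p' \<in> hiding_strategies n"
  have p: "p \<in> restricted_strategies n \<delta>"
    using lp by (simp add: lp_optimal_def lp_feasible_def)
  \<comment> \<open>That the lower bounds sum to at most 1 is read off from the existence of a
    feasible \<open>p\<close>.\<close>
  then have "(\<Sum>i=1..n. \<delta> i) \<le> (\<Sum>i=1..n. p i)"
    by (intro sum_mono) (simp add: restricted_strategies_def)
  then have "(\<Sum>i=1..n. \<delta> i) \<le> 1"
    using p by (simp add: restricted_strategies_def)
  then obtain q where q: "q \<in> restricted_strategies n \<delta>" "u_min n t \<alpha> p' \<le> u_min n t \<alpha> q"
    using ex_restricted_u_min_ge[OF _ p'] by blast
  obtain y where y: "u_min n t \<alpha> q = ereal y"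
    using u_min_eq_real[OF n_ge_1 positive_hiding[OF restricted_positive[OF q(1)]]] by auto
  have "lp_feasible n t \<alpha> \<delta> D q y"
    using q(1) D unfolding lp_feasible_def y[symmetric] u_min_def by (auto intro: INF_lower)
  then have "y \<le> v"
    using lp by (auto simp: lp_optimal_def)
  then show "u_min n t \<alpha> p' \<le> ereal v"
    using q(2) y by (auto intro: order_trans)
qed

section \<open>Families of sequences with uniformly bounded costs\<close>

definition bounded_seqs :: "(nat \<Rightarrow> nat) set \<Rightarrow> bool" where
  "bounded_seqs D \<longleftrightarrow> D \<subseteq> search_seqs n \<and> (\<exists>B. \<forall>\<xi>\<in>D. \<forall>i\<in>{1..n}. u_box t \<alpha> i \<xi> \<le> ereal B)"

lemma bounded_seqs_Un:
  assumes "bounded_seqs D" "bounded_seqs D'"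
  shows "bounded_seqs (D \<union> D')"
proof -
  obtain B B' where B: "\<forall>\<xi>\<in>D. \<forall>i\<in>{1..n}. u_box t \<alpha> i \<xi> \<le> ereal B"
    and B': "\<forall>\<xi>\<in>D'. \<forall>i\<in>{1..n}. u_box t \<alpha> i \<xi> \<le> ereal B'"
    using assms by (auto simp: bounded_seqs_def)
  have "u_box t \<alpha> i \<xi> \<le> ereal (max B B')" if "\<xi> \<in> D \<union> D'" "i \<in> {1..n}" for \<xi> i
  proof -
    have "u_box t \<alpha> i \<xi> \<le> ereal B \<or> u_box t \<alpha> i \<xi> \<le> ereal B'"
      using that B B' by blast
    then show ?thesis
      by (auto intro: order_trans)
  qed
  then show ?thesis
    using assms unfolding bounded_seqs_def by blast
qed

lemma bounded_seqs_mono: "bounded_seqs D' \<Longrightarrow> D \<subseteq> D' \<Longrightarrow> bounded_seqs D"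
  unfolding bounded_seqs_def by blast

text \<open>The cost in box \<open>i\<close> is at most \<open>M / p i\<close>; the sum of these
  bounds serves all boxes and sequences at once, as approachability requires.\<close>

lemma bounded_seqs_gittins:
  assumes p: "p \<in> positive_strategies"
  shows "bounded_seqs {\<xi>. gittins_seq n t \<alpha> p \<xi>}"
proof -
  let ?B = "\<Sum>i=1..n. M_const n t \<alpha> / p i"
  have "u_box t \<alpha> i \<xi> \<le> ereal ?B" if G: "gittins_seq n t \<alpha> p \<xi>" and i: "i \<in> {1..n}" for \<xi> i
  proof -
    have "M_const n t \<alpha> / p i \<le> ?B"
      using i positive_pos[OF p] M_const_nonneg by (intro member_le_sum) (auto simp: less_imp_le)
    then show ?thesis
      using gittins_u_box_le[OF positive_hiding[OF p] G i positive_pos[OF p i]] by (auto intro: order_trans)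
  qed
  then show ?thesis
    unfolding bounded_seqs_def by (intro conjI exI[of _ ?B]) (auto intro: gittins_seq_search_seqs)
qed

lemma bounded_seqs_D_init:
  "bounded_seqs (D_init n t \<alpha>)"
proof (rule bounded_seqs_mono[OF bounded_seqs_gittins])
  have frac: "0 < t i / \<alpha> i" if "i \<in> {1..n}" for i
    using t_pos[OF that] \<alpha>_pos[OF that] by simp
  have pos: "0 < (\<Sum>j=1..n. t j / \<alpha> j)"
    using n_ge_1 by (intro sum_pos frac) auto
  then have *: "0 < p_init n t \<alpha> i" if "i \<in> {1..n}" for i
    using divide_pos_pos[OF frac[OF that]] by (simp add: p_init_def)
  have "(\<Sum>i=1..n. p_init n t \<alpha> i) = 1"
    unfolding p_init_def sum_divide_distrib[symmetric] using pos by simp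
  then show "p_init n t \<alpha> \<in> positive_strategies"
    using * by (simp add: positive_strategies_def hiding_strategies_def less_imp_le)
  show "D_init n t \<alpha> \<subseteq> {\<xi>. gittins_seq n t \<alpha> (p_init n t \<alpha>) \<xi>}"
  proof
    fix \<xi> assume "\<xi> \<in> D_init n t \<alpha>"
    then obtain l where *: "find (\<lambda>j. j \<in> gittins_boxes n t \<alpha> (p_init n t \<alpha>) (num_searches \<xi> s))
        (rotate l [1..<Suc n]) = Some (\<xi> s)" for s
      by (auto simp: D_init_def gittins_seq_pref_def)
    have "\<xi> s \<in> gittins_boxes n t \<alpha> (p_init n t \<alpha>) (num_searches \<xi> s)" for s
      using *[of s] unfolding find_Some_iff by auto
    then show "\<xi> \<in> {\<xi>. gittins_seq n t \<alpha> (p_init n t \<alpha>) \<xi>}"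
      by (simp add: gittins_seq_def)
  qed
qed

lemma bounded_seqs_real:
  assumes "bounded_seqs D" "\<xi> \<in> D" "i \<in> {1..n}"
  shows "u_box t \<alpha> i \<xi> = ereal (real_of_ereal (u_box t \<alpha> i \<xi>))"
  using assms u_box_nonneg'[of \<xi> i] unfolding bounded_seqs_def
  by (cases "u_box t \<alpha> i \<xi>") force+

lemma u_hide_bounded_seqs:
  assumes "bounded_seqs D" "\<xi> \<in> D"
  shows "u_hide n t \<alpha> p \<xi> = ereal (\<Sum>i=1..n. p i * real_of_ereal (u_box t \<alpha> i \<xi>))"
  using bounded_seqs_real[OF assms] by (rule u_hide_eq_real)

lemma u_box_mixed_bounded_seqs:
  assumes D: "bounded_seqs D" and \<theta>: "\<theta> \<in> mixed_strategies D" and i: "i \<in> {1..n}"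
  shows "u_box_mixed t \<alpha> i \<theta> =
    ereal (measure_pmf.expectation \<theta> (\<lambda>\<xi>. real_of_ereal (u_box t \<alpha> i \<xi>)))"
proof -
  have fin: "finite (set_pmf \<theta>)" and sub: "set_pmf \<theta> \<subseteq> D"
    using \<theta> by (auto simp: mixed_strategies_def)
  have "u_box_mixed t \<alpha> i \<theta> = (\<Sum>\<xi>\<in>set_pmf \<theta>. ereal (pmf \<theta> \<xi> * real_of_ereal (u_box t \<alpha> i \<xi>)))"
    unfolding u_box_mixed_def
  proof (rule sum.cong[OF refl])
    fix \<xi> assume "\<xi> \<in> set_pmf \<theta>"
    then show "ereal (pmf \<theta> \<xi>) * u_box t \<alpha> i \<xi> = ereal (pmf \<theta> \<xi> * real_of_ereal (u_box t \<alpha> i \<xi>))"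
      using sub by (subst bounded_seqs_real[OF D _ i]) auto
  qed
  also have "\<dots> = ereal (measure_pmf.expectation \<theta> (\<lambda>\<xi>. real_of_ereal (u_box t \<alpha> i \<xi>)))"
    using fin by (subst integral_measure_pmf[where A = "set_pmf \<theta>"]) auto
  finally show ?thesis .
qed

lemma u_mixed_bounded_seqs:
  assumes D: "bounded_seqs D" and \<theta>: "\<theta> \<in> mixed_strategies D"
  shows "u_mixed n t \<alpha> p \<theta> =
    ereal (\<Sum>i=1..n. p i * measure_pmf.expectation \<theta> (\<lambda>\<xi>. real_of_ereal (u_box t \<alpha> i \<xi>)))"
proof -
  have fin: "finite (set_pmf \<theta>)" and sub: "set_pmf \<theta> \<subseteq> D"
    using \<theta> by (auto simp: mixed_strategies_def)
  let ?x = "\<lambda>\<xi> i. real_of_ereal (u_box t \<alpha> i \<xi>)"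
  have "u_mixed n t \<alpha> p \<theta> = (\<Sum>\<xi>\<in>set_pmf \<theta>. ereal (pmf \<theta> \<xi> * (\<Sum>i=1..n. p i * ?x \<xi> i)))"
    unfolding u_mixed_def by (intro sum.cong refl) (use u_hide_bounded_seqs[OF D] sub in auto)
  also have "\<dots> = ereal (\<Sum>\<xi>\<in>set_pmf \<theta>. \<Sum>i=1..n. p i * (pmf \<theta> \<xi> * ?x \<xi> i))"
    by (simp add: sum_distrib_left mult.left_commute)
  also have "(\<Sum>\<xi>\<in>set_pmf \<theta>. \<Sum>i=1..n. p i * (pmf \<theta> \<xi> * ?x \<xi> i)) =
      (\<Sum>i=1..n. p i * (\<Sum>\<xi>\<in>set_pmf \<theta>. pmf \<theta> \<xi> * ?x \<xi> i))"
    by (subst sum.swap) (simp add: sum_distrib_left)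
  also have "\<dots> = (\<Sum>i=1..n. p i * measure_pmf.expectation \<theta> (\<lambda>\<xi>. ?x \<xi> i))"
    using fin by (subst integral_measure_pmf[where A = "set_pmf \<theta>"]) auto
  finally show ?thesis .
qed

text \<open>The strictness of the constraints at \<open>p\<close> enters through this step: the
  segment from \<open>p\<close> towards any hiding strategy starts inside the restricted
  set.\<close>

lemma ex_convex_step_restricted:
  assumes p: "p \<in> hiding_strategies n"
    and interior: "\<forall>i\<in>{1..n}. \<delta> i < p i"
  obtains s where "0 < s" "s < 1"
    "\<And>q. q \<in> hiding_strategies n \<Longrightarrow> (\<lambda>i. (1 - s) * p i + s * q i) \<in> restricted_strategies n \<delta>"
proof -
  have "p i \<le> 1" if "i \<in> {1..n}" for i
    using member_le_sum[OF that, of p] hiding_nonneg[OF p] hiding_sum[OF p] by auto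
  then obtain s where s: "0 < s" "s < 1" "\<And>i. i \<in> {1..n} \<Longrightarrow> \<delta> i \<le> (1 - s) * p i"
    using ex_convex_step[of "{1..n}" \<delta> p] n_ge_1 interior hiding_nonneg[OF p] by auto
  have "(\<lambda>i. (1 - s) * p i + s * q i) \<in> restricted_strategies n \<delta>" if q: "q \<in> hiding_strategies n" for q
  proof -
    have "\<delta> i \<le> (1 - s) * p i + s * q i" if i: "i \<in> {1..n}" for i
      using s(3)[OF i] s(1) hiding_nonneg[OF q i] by (simp add: add_increasing2)
    moreover have "(\<Sum>i=1..n. (1 - s) * p i + s * q i) = 1"
      using hiding_sum[OF p] hiding_sum[OF q] by (simp add: sum.distrib flip: sum_distrib_left)
    ultimately show ?thesis
      by (simp add: restricted_strategies_def)
  qed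
  with s(1,2) show thesis
    by (rule that)
qed

lemma sum_convex_comb:
  "(\<Sum>i=1..n. ((1 - s) * p i + s * q i) * x i) = (1 - s) * (\<Sum>i=1..n. p i * x i) + s * (\<Sum>i=1..n. q i * x i)"
  for p q x :: "nat \<Rightarrow> real"
  by (simp add: distrib_right sum.distrib sum_distrib_left mult.assoc)

text \<open>Otherwise a short step from \<open>p\<close> towards \<open>q\<close> would stay
  feasible and raise the objective to \<open>v + s * \<gamma>\<close>.\<close>

lemma lp_interior_response:
  assumes D: "bounded_seqs D" and lp: "lp_optimal n t \<alpha> \<delta> D p v"
    and p: "p \<in> hiding_strategies n" and interior: "\<forall>i\<in>{1..n}. \<delta> i < p i"
    and q: "q \<in> hiding_strategies n" and \<gamma>: "0 < \<gamma>"
  shows "\<exists>\<xi>\<in>D. u_hide n t \<alpha> q \<xi> < ereal (v + \<gamma>)"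
proof (rule ccontr)
  assume "\<not> ?thesis"
  then have ge: "ereal (v + \<gamma>) \<le> u_hide n t \<alpha> q \<xi>" if "\<xi> \<in> D" for \<xi>
    using that by (auto simp: not_less)
  obtain s where s: "0 < s" "s < 1"
    and res: "(\<lambda>i. (1 - s) * p i + s * q i) \<in> restricted_strategies n \<delta>"
    using ex_convex_step_restricted[OF p interior] q by metis
  have "ereal (v + s * \<gamma>) \<le> u_hide n t \<alpha> (\<lambda>i. (1 - s) * p i + s * q i) \<xi>" if \<xi>: "\<xi> \<in> D" for \<xi>
  proof -
    have "ereal v \<le> u_hide n t \<alpha> p \<xi>"
      using lp \<xi> by (simp add: lp_optimal_def lp_feasible_def)
    then have "(1 - s) * v + s * (v + \<gamma>) \<le>
        (1 - s) * (\<Sum>i=1..n. p i * real_of_ereal (u_box t \<alpha> i \<xi>)) +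
        s * (\<Sum>i=1..n. q i * real_of_ereal (u_box t \<alpha> i \<xi>))"
      using ge[OF \<xi>] s by (intro add_mono mult_left_mono) (auto simp: u_hide_bounded_seqs[OF D \<xi>])
    moreover have "(1 - s) * v + s * (v + \<gamma>) = v + s * \<gamma>"
      by (simp add: algebra_simps)
    ultimately show ?thesis
      unfolding u_hide_bounded_seqs[OF D \<xi>] sum_convex_comb by simp
  qed
  then have "lp_feasible n t \<alpha> \<delta> D (\<lambda>i. (1 - s) * p i + s * q i) (v + s * \<gamma>)"
    using res by (simp add: lp_feasible_def)
  then have "v + s * \<gamma> \<le> v"
    using lp unfolding lp_optimal_def by blast
  then show False
    using mult_pos_pos[OF s(1) \<gamma>] by simp
qed

text \<open>Approachability is applied to the costs in excess of \<open>v + \<gamma>\<close>, where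
  \<open>lp_interior_response\<close> answers the normalized weights. The second \<gamma> is the
  tolerance of approachability.\<close>

lemma ex_near_optimal_search:
  assumes D: "bounded_seqs D" and lp: "lp_optimal n t \<alpha> \<delta> D p v"
    and p: "p \<in> hiding_strategies n" and interior: "\<forall>i\<in>{1..n}. \<delta> i < p i"
    and \<gamma>: "0 < \<gamma>"
  obtains \<theta> where "\<theta> \<in> mixed_strategies D"
    "\<And>i. i \<in> {1..n} \<Longrightarrow> measure_pmf.expectation \<theta> (\<lambda>\<xi>. real_of_ereal (u_box t \<alpha> i \<xi>)) \<le> v + 2 * \<gamma>"
proof -
  let ?u = "\<lambda>\<xi> i. real_of_ereal (u_box t \<alpha> i \<xi>)"
  define x where "x \<xi> i = ?u \<xi> i - (v + \<gamma>)" for \<xi> i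
  obtain B where B: "\<forall>\<xi>\<in>D. \<forall>i\<in>{1..n}. u_box t \<alpha> i \<xi> \<le> ereal B" and sub: "D \<subseteq> search_seqs n"
    using D by (auto simp: bounded_seqs_def)
  have bound: "\<forall>\<xi>\<in>D. (\<Sum>i=1..n. (x \<xi> i)\<^sup>2) \<le> (\<Sum>i=1..n. (\<bar>B\<bar> + \<bar>v + \<gamma>\<bar>)\<^sup>2)"
  proof (intro ballI sum_mono)
    fix \<xi> i assume \<xi>: "\<xi> \<in> D" and i: "i \<in> {1..n}"
    have "0 \<le> ?u \<xi> i" "?u \<xi> i \<le> B"
    proof -
      show "0 \<le> ?u \<xi> i"
        using sub \<xi> i by (intro real_of_ereal_pos u_box_nonneg') auto
      have "u_box t \<alpha> i \<xi> \<le> ereal B"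
        using B \<xi> i by blast
      then show "?u \<xi> i \<le> B"
        by (subst (asm) bounded_seqs_real[OF D \<xi> i]) simp
    qed
    then have "\<bar>x \<xi> i\<bar> \<le> \<bar>\<bar>B\<bar> + \<bar>v + \<gamma>\<bar>\<bar>"
      by (simp add: x_def)
    then show "(x \<xi> i)\<^sup>2 \<le> (\<bar>B\<bar> + \<bar>v + \<gamma>\<bar>)\<^sup>2"
      by (simp only: abs_le_square_iff)
  qed
  have response: "\<forall>w. (\<forall>i\<in>{1..n}. 0 \<le> w i) \<longrightarrow> (\<exists>\<xi>\<in>D. (\<Sum>i=1..n. w i * x \<xi> i) \<le> 0)"
  proof (intro allI impI)
    fix w :: "nat \<Rightarrow> real" assume w: "\<forall>i\<in>{1..n}. 0 \<le> w i"
    define W where "W = (\<Sum>i=1..n. w i)"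
    \<comment> \<open>If all weights vanish, any answer will do and \<open>p\<close> is a
      placeholder.\<close>
    define q where "q = (if W = 0 then p else (\<lambda>i. w i / W))"
    have W: "0 \<le> W"
      unfolding W_def using w by (intro sum_nonneg) blast
    have "q \<in> hiding_strategies n"
      using p w W by (auto simp: q_def hiding_strategies_def W_def simp flip: sum_divide_distrib)
    then obtain \<xi> where \<xi>: "\<xi> \<in> D" "u_hide n t \<alpha> q \<xi> < ereal (v + \<gamma>)"
      using lp_interior_response[OF D lp p interior _ \<gamma>] by blast
    have "w i = W * q i" if "i \<in> {1..n}" for i
      using w that sum_nonneg_eq_0_iff[of "{1..n}" w] by (auto simp: q_def W_def)
    then have "(\<Sum>i=1..n. w i * x \<xi> i) = (\<Sum>i=1..n. W * (q i * ?u \<xi> i) - w i * (v + \<gamma>))"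
      by (intro sum.cong refl) (simp add: x_def algebra_simps)
    also have "\<dots> = W * ((\<Sum>i=1..n. q i * ?u \<xi> i) - (v + \<gamma>))"
      by (simp add: sum_subtractf right_diff_distrib W_def flip: sum_distrib_left sum_distrib_right)
    also have "\<dots> \<le> 0"
      using W \<xi>(2) by (intro mult_nonneg_nonpos) (auto simp: u_hide_bounded_seqs[OF D \<xi>(1)])
    finally show "\<exists>\<xi>\<in>D. (\<Sum>i=1..n. w i * x \<xi> i) \<le> 0"
      using \<xi>(1) by blast
  qed
  obtain \<theta> where \<theta>: "finite (set_pmf \<theta>)" "set_pmf \<theta> \<subseteq> D"
    "\<And>i. i \<in> {1..n} \<Longrightarrow> measure_pmf.expectation \<theta> (\<lambda>\<xi>. x \<xi> i) \<le> \<gamma>"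
    using blackwell_approachability[OF finite_atLeastAtMost bound response \<gamma>] by blast
  show thesis
  proof (rule that)
    show "\<theta> \<in> mixed_strategies D"
      using \<theta> by (simp add: mixed_strategies_def)
    fix i assume i: "i \<in> {1..n}"
    have "measure_pmf.expectation \<theta> (\<lambda>\<xi>. x \<xi> i) =
        measure_pmf.expectation \<theta> (\<lambda>\<xi>. ?u \<xi> i) - (v + \<gamma>)"
      unfolding x_def using \<theta>(1) by (simp add: integrable_measure_pmf_finite)
    then show "measure_pmf.expectation \<theta> (\<lambda>\<xi>. ?u \<xi> i) \<le> v + 2 * \<gamma>"
      using \<theta>(3)[OF i] by simp
  qed
qed

text \<open>In the restricted game \<theta> is no worse than the near-optimal mixtures, whose excess
  over \<open>v\<close> is arbitrarily small.\<close>

lemma optimal_search_SUP_le: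
  assumes D: "bounded_seqs D" and lp: "lp_optimal n t \<alpha> \<delta> D p v"
    and p: "p \<in> hiding_strategies n"
    and interior: "\<forall>i\<in>{1..n}. \<delta> i < p i"
    and opt: "optimal_search n t \<alpha> \<delta> D \<theta>"
  shows "(SUP q\<in>restricted_strategies n \<delta>. u_mixed n t \<alpha> q \<theta>) \<le> ereal v"
proof (rule ereal_le_epsilon2)
  fix e :: real assume e: "0 < e"
  then obtain \<theta>' where \<theta>': "\<theta>' \<in> mixed_strategies D"
    and le: "\<And>i. i \<in> {1..n} \<Longrightarrow>
      measure_pmf.expectation \<theta>' (\<lambda>\<xi>. real_of_ereal (u_box t \<alpha> i \<xi>)) \<le> v + e"
    using ex_near_optimal_search[OF D lp p interior, of "e / 2"] by auto
  have "(SUP q\<in>restricted_strategies n \<delta>. u_mixed n t \<alpha> q \<theta>) \<le>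
      (SUP q\<in>restricted_strategies n \<delta>. u_mixed n t \<alpha> q \<theta>')"
    using opt \<theta>' by (auto simp: optimal_search_def is_arg_min_def not_less)
  also have "\<dots> \<le> ereal (v + e)"
  proof (rule SUP_least)
    fix q assume "q \<in> restricted_strategies n \<delta>"
    then have q: "q \<in> hiding_strategies n"
      by (intro positive_hiding restricted_positive)
    have "(\<Sum>i=1..n. q i * measure_pmf.expectation \<theta>' (\<lambda>\<xi>. real_of_ereal (u_box t \<alpha> i \<xi>))) \<le>
        (\<Sum>i=1..n. q i * (v + e))"
      using le hiding_nonneg[OF q] by (intro sum_mono mult_left_mono)
    also have "\<dots> = v + e"
      using hiding_sum[OF q] by (simp flip: sum_distrib_right)
    finally show "u_mixed n t \<alpha> q \<theta>' \<le> ereal (v + e)"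
      by (simp add: u_mixed_bounded_seqs[OF D \<theta>'])
  qed
  finally show "(SUP q\<in>restricted_strategies n \<delta>. u_mixed n t \<alpha> q \<theta>) \<le> ereal v + ereal e"
    by simp
qed

text \<open>Every sequence of \<open>D\<close> costs at least \<open>v\<close> at \<open>p\<close>,
  hence so does \<theta>; a little further towards box \<open>i\<close> it costs at most
  \<open>v\<close>. By linearity it costs at most \<open>v\<close> at the far end of the
  segment.\<close>

lemma optimal_search_u_box_mixed_le:
  assumes D: "bounded_seqs D" and lp: "lp_optimal n t \<alpha> \<delta> D p v"
    and p: "p \<in> hiding_strategies n"
    and interior: "\<forall>i\<in>{1..n}. \<delta> i < p i"
    and opt: "optimal_search n t \<alpha> \<delta> D \<theta>" and i: "i \<in> {1..n}"
  shows "u_box_mixed t \<alpha> i \<theta> \<le> ereal v"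
proof -
  have \<theta>: "\<theta> \<in> mixed_strategies D"
    using opt by (simp add: optimal_search_def is_arg_min_def)
  let ?E = "\<lambda>i. measure_pmf.expectation \<theta> (\<lambda>\<xi>. real_of_ereal (u_box t \<alpha> i \<xi>))"
  define q :: "nat \<Rightarrow> real" where "q j = of_bool (j = i)" for j
  have q: "q \<in> hiding_strategies n"
    using i by (simp add: hiding_strategies_def q_def of_bool_def)
  obtain s where s: "0 < s" "s < 1"
    and res: "(\<lambda>i. (1 - s) * p i + s * q i) \<in> restricted_strategies n \<delta>"
    using ex_convex_step_restricted[OF p interior] q by metis
  have "u_mixed n t \<alpha> (\<lambda>i. (1 - s) * p i + s * q i) \<theta> \<le> ereal v"
    using SUP_upper[OF res] optimal_search_SUP_le[OF D lp p interior opt] by (rule order_trans)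
  moreover have "(\<Sum>j=1..n. q j * ?E j) = ?E i"
    using i by (simp add: q_def of_bool_def if_distrib[of "\<lambda>c. c * _"] cong: if_cong)
  ultimately have "(1 - s) * (\<Sum>j=1..n. p j * ?E j) + s * ?E i \<le> v"
    unfolding u_mixed_bounded_seqs[OF D \<theta>] sum_convex_comb by simp
  moreover have "v \<le> (\<Sum>j=1..n. p j * ?E j)"
  proof -
    have fin: "finite (set_pmf \<theta>)" and sub: "set_pmf \<theta> \<subseteq> D"
      using \<theta> by (auto simp: mixed_strategies_def)
    have "ereal v = (\<Sum>\<xi>\<in>set_pmf \<theta>. ereal (pmf \<theta> \<xi>) * ereal v)"
      using fin by (simp add: sum_pmf_eq_1 flip: sum_distrib_right)
    also have "\<dots> \<le> u_mixed n t \<alpha> p \<theta>"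
      unfolding u_mixed_def using lp sub
      by (intro sum_mono ereal_mult_left_mono) (auto simp: lp_optimal_def lp_feasible_def)
    finally show ?thesis
      by (simp add: u_mixed_bounded_seqs[OF D \<theta>])
  qed
  then have "(1 - s) * v \<le> (1 - s) * (\<Sum>j=1..n. p j * ?E j)"
    using s by (intro mult_left_mono) auto
  ultimately have "s * ?E i \<le> s * v"
    by (simp add: algebra_simps)
  then show ?thesis
    using s by (simp add: u_box_mixed_bounded_seqs[OF D \<theta> i])
qed

lemma algorithm_bounded_seqs:
  assumes run: "algorithm_run n t \<alpha> \<delta> \<epsilon> K D p v \<xi> U L"
  shows "k \<in> {1..K} \<Longrightarrow> bounded_seqs (D k)"
proof (induction k)
  case (Suc k)
  show ?case
  \<comment> \<open>Iterations are numbered from 1, so \<open>D_init\<close> appears as the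
    successor of 0.\<close>
  proof (cases "k = 0")
    case True
    then show ?thesis
      using run bounded_seqs_D_init by (simp add: algorithm_run_def)
  next
    case False
    then have k: "k \<in> {1..K}" "D (Suc k) = insert (\<xi> k) (D k)"
      using run Suc.prems by (auto simp: algorithm_run_def)
    then have G: "gittins_seq n t \<alpha> (p k) (\<xi> k)" and res: "p k \<in> restricted_strategies n \<delta>"
      using run by (auto simp: algorithm_run_def lp_optimal_def lp_feasible_def)
    have "bounded_seqs ({\<xi>. gittins_seq n t \<alpha> (p k) \<xi>} \<union> D k)"
      by (intro bounded_seqs_Un bounded_seqs_gittins restricted_positive[OF res] Suc.IH[OF k(1)])
    then show ?thesis
      by (rule bounded_seqs_mono) (use G k(2) in auto)
  qed
qed simp

end

theorem mainTheorem2: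
  fixes n :: nat and t \<alpha> \<delta> :: "nat \<Rightarrow> real" and \<epsilon> :: real and k :: nat
    and D :: "nat \<Rightarrow> (nat \<Rightarrow> nat) set" and p :: "nat \<Rightarrow> nat \<Rightarrow> real" and v :: "nat \<Rightarrow> real"
    and \<xi> :: "nat \<Rightarrow> nat \<Rightarrow> nat" and U :: "nat \<Rightarrow> real" and L :: "nat \<Rightarrow> ereal"
  assumes "1 \<le> n"
    and "\<And>i. i \<in> {1..n} \<Longrightarrow> 0 < t i"
    and "\<And>i. i \<in> {1..n} \<Longrightarrow> 0 < \<alpha> i \<and> \<alpha> i < 1"
    and "\<And>i. i \<in> {1..n} \<Longrightarrow> 0 < \<delta> i \<and> \<delta> i < \<eta>_const n t \<alpha> i"
    and "0 < \<epsilon>"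
    and "algorithm_run n t \<alpha> \<delta> \<epsilon> k D p v \<xi> U L"
  shows "L k \<le> game_value n t \<alpha> \<and> game_value n t \<alpha> \<le> ereal (U k) \<and>
    (stop_condition n \<delta> \<epsilon> (p k) (U k) (L k) \<longrightarrow>
      ereal (U k) / L k - 1 < ereal \<epsilon> \<and>
      (\<forall>\<zeta>\<in>search_seqs n. L k \<le> u_hide n t \<alpha> (p k) \<zeta>) \<and>
      (\<forall>\<theta>. optimal_search n t \<alpha> \<delta> (D k) \<theta> \<longrightarrow> (\<forall>i\<in>{1..n}. u_box_mixed t \<alpha> i \<theta> \<le> ereal (U k))))"
proof -
  interpret bounded_search_game n t \<alpha> \<delta>
    using assms(1-4) by unfold_locales auto
  have lp: "lp_optimal n t \<alpha> \<delta> (D k) (p k) (v k)" and U: "U k = v k"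
    and G: "gittins_seq n t \<alpha> (p k) (\<xi> k)" and L: "L k = u_hide n t \<alpha> (p k) (\<xi> k)"
    using assms(6) by (auto simp: algorithm_run_def)
  have D: "bounded_seqs (D k)"
    by (rule algorithm_bounded_seqs[OF assms(6)]) (use assms(6) in \<open>simp add: algorithm_run_def\<close>)
  have "p k \<in> restricted_strategies n \<delta>"
    using lp by (simp add: lp_optimal_def lp_feasible_def)
  note pos = restricted_positive[OF this]
  note hiding = positive_hiding[OF pos]
  \<comment> \<open>Gittins optimality turns the computed \<open>L k\<close> into
    \<open>u_min\<close> at \<open>p k\<close>, one of the values in the supremum.\<close>
  have "L k \<le> game_value n t \<alpha>"
    unfolding L gittins_u_hide_eq_u_min[OF pos G] game_value_def using hiding by (rule SUP_upper)
  moreover have "game_value n t \<alpha> \<le> ereal (U k)"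
    unfolding U using D by (intro game_value_le_lp[OF _ lp]) (simp add: bounded_seqs_def)
  moreover have "L k \<le> u_hide n t \<alpha> (p k) \<zeta>" if "\<zeta> \<in> search_seqs n" for \<zeta>
    unfolding L using gittins_optimal[OF pos G that] .
  moreover have "u_box_mixed t \<alpha> i \<theta> \<le> ereal (U k)"
    if "stop_condition n \<delta> \<epsilon> (p k) (U k) (L k)" "optimal_search n t \<alpha> \<delta> (D k) \<theta>" "i \<in> {1..n}" for \<theta> i
    unfolding U by (rule optimal_search_u_box_mixed_le[OF D lp hiding _ that(2,3)])
      (use that(1) in \<open>simp add: stop_condition_def\<close>)
  ultimately show ?thesis
    by (auto simp: stop_condition_def)
qed

end
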